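(* For every $\varepsilon>0$ there is $d_0=d_0(\varepsilon)$ such that, for every $d\ge d_0$, \[ \lim_{n\to\infty}\mathbb{P}\left( \log c(G(n,d/n))\ge\frac{\pi^2/6-\varepsilon}{d} \right)=1. \]
   Context: For a finite graph $G=(V,E)$ with connected components $C_1,\dots,C_k$, fix a root $r_i\in C_i$ in each component and let \[ P_G=\{x\in\mathbb{R}^V: x(r_i)=0 \text{ for all } i,\ |x(u)-x(v)|\le 1 \text{ for all } uv\in E\}. \] The growth constant $c(G)>0$ is defined by $c(G)^{|V|-k}=\mathrm{Vol}(P_G)$ (volume in the coordinate space of the non-root vertices; independent of the choice of roots). $G(n,d/n)$ is the Erdős–Rényi random graph on $[n]$ with edge probability $d/n$. *)

theory Defs
  imports "HOL-Probability.Probability"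
begin

definition all_edges :: "'a set \<Rightarrow> 'a set set" where
  "all_edges V = {e. e \<subseteq> V \<and> card e = 2}"

text \<open>A finite simple graph is given by a finite vertex set and a set of two-element
  subsets of it.\<close>

definition finite_graph :: "'a set \<Rightarrow> 'a set set \<Rightarrow> bool" where
  "finite_graph V E \<longleftrightarrow> finite V \<and> E \<subseteq> all_edges V"

definition reachable :: "'a set \<Rightarrow> 'a set set \<Rightarrow> ('a \<times> 'a) set" where
  "reachable V E = {(u, v). {u, v} \<in> E}\<^sup>* \<inter> V \<times> V"

definition graph_components :: "'a set \<Rightarrow> 'a set set \<Rightarrow> 'a set set" where
  "graph_components V E = V // reachable V E"

definition is_root_set :: "'a set \<Rightarrow> 'a set set \<Rightarrow> 'a set \<Rightarrow> bool" where
  "is_root_set V E R \<longleftrightarrow> R \<subseteq> V \<and> (\<forall>C \<in> graph_components V E. \<exists>!r. r \<in> R \<inter> C)"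

text \<open>Vectors in \<open>\<real>\<^sup>V\<close> are extensional functions on \<open>V\<close>.\<close>

definition graph_polytope :: "'a set \<Rightarrow> 'a set set \<Rightarrow> 'a set \<Rightarrow> ('a \<Rightarrow> real) set" where
  "graph_polytope V E R =
     {x \<in> V \<rightarrow>\<^sub>E UNIV. (\<forall>r \<in> R. x r = 0) \<and> (\<forall>u v. {u, v} \<in> E \<longrightarrow> \<bar>x u - x v\<bar> \<le> 1)}"

definition polytope_volume :: "'a set \<Rightarrow> 'a set set \<Rightarrow> 'a set \<Rightarrow> real" where
  "polytope_volume V E R =
     measure (\<Pi>\<^sub>M v \<in> V - R. lborel) ((\<lambda>x. restrict x (V - R)) ` graph_polytope V E R)"

text \<open>The volume does not depend on the choice of roots. If the graph has no edges, then the
  exponent is \<open>0\<close>, the volume is \<open>1\<close>, and the defining equation holds for every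
  positive number; the value is then set to \<open>1\<close>.\<close>

definition growth_constant :: "'a set \<Rightarrow> 'a set set \<Rightarrow> real" where
  "growth_constant V E =
     (let R = (SOME R. is_root_set V E R); m = card V - card (graph_components V E)
      in if m = 0 then 1 else (THE c. c > 0 \<and> c ^ m = polytope_volume V E R))"

text \<open>The distribution of the edge set of a random graph on \<open>{1..n}\<close>. For \<open>p\<close> outside
  \<open>[0, 1]\<close> the library's Bernoulli distribution replaces \<open>p\<close> by the nearest point of
  that interval.\<close>

definition erdos_renyi :: "nat \<Rightarrow> real \<Rightarrow> nat set set pmf" where
  "erdos_renyi n p =
     map_pmf (\<lambda>f. {e \<in> all_edges {1..n}. f e})
       (Pi_pmf (all_edges {1..n}) False (\<lambda>_. bernoulli_pmf p))"


subsection \<open>Well-definedness\<close>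

lemma equiv_reachable: "equiv V (reachable V E)"
proof (rule equivI)
  show "reachable V E \<subseteq> V \<times> V" by (auto simp: reachable_def)
  show "refl_on V (reachable V E)" by (auto simp: reachable_def refl_on_def)
  have "sym {(u, v). {u, v} \<in> E}" by (auto simp: sym_def insert_commute)
  then have "sym ({(u, v). {u, v} \<in> E}\<^sup>*)" by (rule sym_rtrancl)
  then show "sym (reachable V E)" unfolding reachable_def sym_def by blast
  show "trans (reachable V E)"
    unfolding reachable_def trans_def by (auto intro: rtrancl_trans)
qed

lemma ex_root_set: "\<exists>R. is_root_set V E R"
proof -
  let ?f = "\<lambda>C. SOME r. r \<in> C"
  have f: "?f C \<in> C" "C \<subseteq> V" if "C \<in> graph_components V E" for C
    using that in_quotient_imp_non_empty[OF equiv_reachable, of C V E]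
      in_quotient_imp_subset[OF equiv_reachable, of C V E]
    unfolding graph_components_def by (auto simp: some_in_eq)
  have disj: "C = D" if "C \<in> graph_components V E" "D \<in> graph_components V E" "x \<in> C" "x \<in> D" for C D x
    using that quotient_disj[OF equiv_reachable] unfolding graph_components_def by fast
  have "is_root_set V E (?f ` graph_components V E)"
    unfolding is_root_set_def
  proof (intro conjI ballI)
    show "?f ` graph_components V E \<subseteq> V" using f by fast
  next
    fix C assume C: "C \<in> graph_components V E"
    show "\<exists>!r. r \<in> ?f ` graph_components V E \<inter> C"
    proof (rule ex1I[of _ "?f C"])
      show "?f C \<in> ?f ` graph_components V E \<inter> C" using C f by blast
    next
      fix r assume "r \<in> ?f ` graph_components V E \<inter> C"
      then obtain D where D: "D \<in> graph_components V E" "r = ?f D" "r \<in> C" by blast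
      then have "D = C" using disj[OF D(1) C, of r] f(1)[OF D(1)] by simp
      then show "r = ?f C" using D by simp
    qed
  qed
  then show ?thesis ..
qed

lemma polytope_volume_pos:
  assumes G: "finite_graph V E" and R: "is_root_set V E R"
  shows "polytope_volume V E R > 0"
proof -
  interpret product_sigma_finite "\<lambda>_::'a. lborel :: real measure" by standard
  let ?W = "V - R" and ?P = "graph_polytope V E R"
  let ?S = "(\<lambda>x. restrict x ?W) ` ?P"
  let ?M = "\<Pi>\<^sub>M v \<in> ?W. (lborel :: real measure)"
  define z where "z = (\<lambda>(y :: 'a \<Rightarrow> real) v. if v \<in> ?W then y v else 0)"
  have fin: "finite V" and RV: "R \<subseteq> V" and finW: "finite ?W"
    using G R by (auto simp: finite_graph_def is_root_set_def)
  have EV: "u \<in> V" "v \<in> V" if "{u, v} \<in> E" for u v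
    using G that by (auto simp: finite_graph_def all_edges_def)
  have S_eq: "?S = {y \<in> space ?M. \<forall>p \<in> {(u, v). {u, v} \<in> E} \<inter> V \<times> V. \<bar>z y (fst p) - z y (snd p)\<bar> \<le> 1}"
    (is "_ = ?T")
  proof (intro equalityI subsetI)
    fix y assume "y \<in> ?S"
    then obtain x where x: "x \<in> ?P" "y = restrict x ?W" by blast
    have "z y v = x v" if "v \<in> V" for v
      using that x by (auto simp: z_def graph_polytope_def)
    then show "y \<in> ?T" using x by (auto simp: space_PiM graph_polytope_def)
  next
    fix y assume y: "y \<in> ?T"
    let ?x = "restrict (z y) V"
    have "\<bar>z y u - z y v\<bar> \<le> 1" if "{u, v} \<in> E" for u v
    proof -
      have "(u, v) \<in> {(u, v). {u, v} \<in> E} \<inter> V \<times> V" using EV[OF that] that by simp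
      moreover have "\<forall>p \<in> {(u, v). {u, v} \<in> E} \<inter> V \<times> V. \<bar>z y (fst p) - z y (snd p)\<bar> \<le> 1"
        using y by blast
      ultimately show ?thesis by (metis fst_conv snd_conv)
    qed
    moreover have "z y r = 0" if "r \<in> R" for r using that by (simp add: z_def)
    ultimately have "?x \<in> ?P" using RV EV by (auto simp: graph_polytope_def)
    moreover have "y = restrict ?x ?W"
    proof
      fix v
      have "y \<in> ?W \<rightarrow>\<^sub>E UNIV" using y by (simp add: space_PiM)
      then have "y v = undefined" if "v \<notin> ?W" using that by (rule PiE_arb)
      then show "y v = restrict ?x ?W v"
        by (cases "v \<in> ?W") (auto simp: z_def)
    qed
    ultimately show "y \<in> ?S" by blast
  qed
  have z_meas: "(\<lambda>y. z y v) \<in> borel_measurable ?M" for v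
  proof (cases "v \<in> ?W")
    case True
    then have "(\<lambda>y. y v) \<in> measurable ?M lborel" by (rule measurable_component_singleton)
    then show ?thesis using True by (simp add: z_def)
  next
    case False
    then have "(\<lambda>y. z y v) = (\<lambda>_. 0)" by (auto simp: z_def fun_eq_iff)
    then show ?thesis by simp
  qed
  have finp: "finite ({(u, v). {u, v} \<in> E} \<inter> V \<times> V)" using fin by blast
  have meas: "?S \<in> sets ?M"
    unfolding S_eq
    by (intro sets.sets_Collect_finite_All[OF _ finp] borel_measurable_le borel_measurable_abs
        borel_measurable_diff z_meas borel_measurable_const)
  let ?L = "\<Pi>\<^sub>E v \<in> ?W. {-1/2..1/2 :: real}"
  have LS: "?L \<subseteq> ?S"
  proof
    fix y assume y: "y \<in> ?L"
    have "\<bar>z y v\<bar> \<le> 1/2" for v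
    proof (cases "v \<in> ?W")
      case True
      then have "y v \<in> {-1/2..1/2}" using y by (rule PiE_mem[rotated])
      then have "\<bar>y v\<bar> \<le> 1/2" unfolding atLeastAtMost_iff by linarith
      then show ?thesis using True by (simp add: z_def del: Diff_iff)
    next
      case False
      then show ?thesis by (simp add: z_def del: Diff_iff)
    qed
    then have "\<bar>z y u - z y v\<bar> \<le> 1" for u v
    proof -
      have "\<bar>z y u\<bar> \<le> 1/2" "\<bar>z y v\<bar> \<le> 1/2" using \<open>\<And>v. \<bar>z y v\<bar> \<le> 1/2\<close> by blast+
      then show ?thesis by linarith
    qed
    moreover have "y \<in> space ?M" using y by (auto simp: space_PiM PiE_iff)
    ultimately show "y \<in> ?S" unfolding S_eq by blast
  qed
  have Lm: "emeasure ?M ?L = 1"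
    by (subst emeasure_PiM[OF finW]) auto
  have bd1: "\<exists>B. \<forall>x \<in> ?P. \<bar>x u - x v\<bar> \<le> B" if "(u, v) \<in> {(u, v). {u, v} \<in> E}\<^sup>*" for u v
    using that
  proof (induction rule: rtrancl_induct)
    case base show ?case by (intro exI[of _ 0]) auto
  next
    case (step v w)
    then obtain B where "\<forall>x \<in> ?P. \<bar>x u - x v\<bar> \<le> B" by blast
    moreover have "\<forall>x \<in> ?P. \<bar>x v - x w\<bar> \<le> 1" using step by (auto simp: graph_polytope_def)
    ultimately have "\<bar>x u - x w\<bar> \<le> B + 1" if "x \<in> ?P" for x
      using that by (smt (verit))
    then have "\<forall>x \<in> ?P. \<bar>x u - x w\<bar> \<le> B + 1" by blast
    then show ?case ..
  qed
  have bd2: "\<exists>B. \<forall>x \<in> ?P. \<bar>x v\<bar> \<le> B" if "v \<in> V" for v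
  proof -
    have "reachable V E `` {v} \<in> graph_components V E"
      using that by (auto simp: graph_components_def intro: quotientI)
    then have "\<exists>!r. r \<in> R \<inter> reachable V E `` {v}"
      using R[unfolded is_root_set_def, THEN conjunct2] by (rule bspec[rotated])
    then obtain r where r: "r \<in> R" "(v, r) \<in> reachable V E"
      by (metis Image_singleton_iff IntE)
    have "(v, r) \<in> {(u, v). {u, v} \<in> E}\<^sup>*" using r(2) by (simp add: reachable_def)
    from bd1[OF this] obtain B where "\<forall>x \<in> ?P. \<bar>x v - x r\<bar> \<le> B" ..
    moreover have "\<forall>x \<in> ?P. x r = 0" using r by (auto simp: graph_polytope_def)
    ultimately have "\<forall>x \<in> ?P. \<bar>x v\<bar> \<le> B" by (metis diff_zero)
    then show ?thesis ..
  qed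
  then have "\<forall>v \<in> V. \<exists>B. \<forall>x \<in> ?P. \<bar>x v\<bar> \<le> B" by blast
  from bchoice[OF this] obtain B where B: "\<forall>v \<in> V. \<forall>x \<in> ?P. \<bar>x v\<bar> \<le> B v" ..
  let ?U = "\<Pi>\<^sub>E v \<in> ?W. {- \<bar>B v\<bar>..\<bar>B v\<bar>}"
  have SU: "?S \<subseteq> ?U"
  proof
    fix y assume "y \<in> ?S"
    then obtain x where x: "x \<in> ?P" "y = restrict x ?W" by blast
    have "x v \<in> {- \<bar>B v\<bar>..\<bar>B v\<bar>}" if "v \<in> V" for v
    proof -
      have "\<bar>x v\<bar> \<le> B v" using B that x(1) by blast
      then show ?thesis by auto
    qed
    then show "y \<in> ?U" using x(2) by auto
  qed
  have "emeasure ?M ?U = (\<Prod>v \<in> ?W. emeasure lborel {- \<bar>B v\<bar>..\<bar>B v\<bar>})"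
    by (subst emeasure_PiM[OF finW]) auto
  also have "\<dots> < \<infinity>" by (simp add: prod_ennreal)
  finally have "emeasure ?M ?U < \<infinity>" .
  moreover have "?U \<in> sets ?M" using finW by (intro sets_PiM_I_finite) auto
  ultimately have "emeasure ?M ?S < \<infinity>"
    using emeasure_mono[OF SU] by (meson order.strict_trans1)
  moreover have "emeasure ?M ?S \<ge> 1" using emeasure_mono[OF LS meas] Lm by simp
  ultimately show ?thesis
    unfolding polytope_volume_def measure_def by (subst enn2real_positive_iff) (auto intro: less_le_trans[OF zero_less_one])
qed

lemma growth_constant:
  assumes "finite_graph V E"
  defines "m \<equiv> card V - card (graph_components V E)"
  obtains R where "is_root_set V E R"
    and "m > 0 \<Longrightarrow> growth_constant V E ^ m = polytope_volume V E R"
    and "growth_constant V E > 0"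
proof -
  define R where "R = (SOME R. is_root_set V E R)"
  have R: "is_root_set V E R" unfolding R_def using ex_root_set by (rule someI_ex)
  let ?v = "polytope_volume V E R"
  have v: "?v > 0" using polytope_volume_pos[OF assms(1) R] .
  have "growth_constant V E > 0 \<and> growth_constant V E ^ m = ?v" if m: "m > 0"
  proof -
    have "growth_constant V E = (THE c. c > 0 \<and> c ^ m = ?v)"
      using m by (simp add: growth_constant_def Let_def m_def R_def)
    moreover have "\<exists>!c. c > 0 \<and> c ^ m = ?v"
      using realpow_pos_nth_unique[OF m v] by simp
    ultimately show ?thesis using theI'[of "\<lambda>c. c > 0 \<and> c ^ m = ?v"] by simp
  qed
  moreover have "growth_constant V E = 1" if "m = 0"
    using that by (simp add: growth_constant_def Let_def m_def)
  ultimately have "growth_constant V E > 0" "m > 0 \<Longrightarrow> growth_constant V E ^ m = ?v"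
    by (cases "m = 0"; simp)+
  then show thesis using that[OF R] by blast
qed

end

theory Submission
  imports Defs "HOL-Real_Asymp.Real_Asymp"
begin

text \<open>
  Confine every coordinate to an interval of length \<open>1 + 2a\<close> with \<open>a = K / d\<close>, and let \<open>Z\<close> be the
  volume of the confined polytope, without roots.

  Whatever the edges at a vertex are, its coordinate may range over the middle \<open>1 - 2a\<close> of the
  interval. So changing the edges at one vertex changes \<open>ln Z\<close> by \<open>O(1 / d)\<close>, and the bounded
  differences method gives \<open>ln Z \<ge> ln (E Z) - O(n / d\<^sup>2)\<close> up to fluctuations that are negligible
  on the scale \<open>n / d\<close>: the first moment alone determines \<open>ln Z\<close> to leading order.

  The first moment is the partition function of a mean-field gas with weight \<open>1 - d / n\<close> per pair
  at distance greater than \<open>1\<close>. Gibbs' variational principle bounds it below by a product measure.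
  At distance \<open>t / d\<close> inside either end of the unit interval the optimal density \<open>\<rho>\<close> solves
  \<open>\<rho> t = exp (- integral of \<rho> over s < - t)\<close>, that is, \<open>\<rho>\<close> is the logistic function. The
  resulting exponent per vertex is \<open>1 / d\<close> times the integral of \<open>- \<rho> ln \<rho>\<close>, which the
  substitution \<open>q = \<rho> t\<close> turns into the integral of \<open>- ln q / (1 - q)\<close> over the unit interval,
  and this is \<open>pi\<^sup>2 / 6\<close>.

  Passing from \<open>Z\<close> to the rooted polytope costs a factor at most \<open>1 + 2a\<close> per root. The roots
  form an independent set, so for large \<open>d\<close> there are few of them.
\<close>

section \<open>Exponential moments under bounded differences\<close>

lemma exp_le_quadratic:
  fixes y :: real
  assumes "\<bar>y\<bar> \<le> 1"
  shows "exp y \<le> 1 + y + y\<^sup>2"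
proof (cases "0 \<le> y")
  case True
  then show ?thesis using assms exp_bound[of y] by simp
next
  case False
  \<comment> \<open>For negative \<open>y\<close> the reciprocal is estimated: \<open>?q\<close> is
    the Taylor lower bound for \<open>exp (- y)\<close>, and \<open>1 / ?q\<close> is at most the
    claimed quadratic because the product of the two quadratics exceeds 1 by terms that are
    nonnegative for \<open>y < 0\<close>.\<close>
  let ?q = "1 - y + y\<^sup>2 / 2"
  have q: "?q \<le> exp (- y)"
    using exp_lower_Taylor_quadratic[of "- y"] False by simp
  have "?q > 0" using False by (simp add: add_pos_nonneg)
  have "(1 + y + y\<^sup>2) * ?q = 1 + y\<^sup>2 / 2 + (- y) * y\<^sup>2 / 2 + y\<^sup>2 * y\<^sup>2 / 2"
    by (simp add: field_simps power2_eq_square)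
  moreover have "0 \<le> (- y) * y\<^sup>2 / 2"
    using False by (intro divide_nonneg_nonneg mult_nonneg_nonneg) auto
  moreover have "0 \<le> y\<^sup>2 / 2" "0 \<le> y\<^sup>2 * y\<^sup>2 / 2" by simp_all
  ultimately have "1 \<le> (1 + y + y\<^sup>2) * ?q" by linarith
  then have "1 / ?q \<le> 1 + y + y\<^sup>2"
    using \<open>?q > 0\<close> by (simp add: pos_divide_le_eq)
  moreover have "exp y \<le> 1 / ?q"
    using q \<open>?q > 0\<close> by (simp add: exp_minus inverse_eq_divide field_simps)
  ultimately show ?thesis by linarith
qed

lemma expectation_pair_pmf_finite:
  fixes f :: "'a \<times> 'b \<Rightarrow> real"
  assumes "finite (set_pmf p)" "finite (set_pmf q)"
  shows "measure_pmf.expectation (pair_pmf p q) f =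
    measure_pmf.expectation p (\<lambda>a. measure_pmf.expectation q (\<lambda>b. f (a, b)))"
proof -
  have "measure_pmf.expectation (pair_pmf p q) f =
      (\<Sum>z\<in>set_pmf p \<times> set_pmf q. f z * pmf (pair_pmf p q) z)"
    using assms by (intro integral_measure_pmf_real) auto
  also have "\<dots> = (\<Sum>a\<in>set_pmf p. \<Sum>b\<in>set_pmf q. f (a, b) * (pmf p a * pmf q b))"
    by (auto simp: sum.cartesian_product pmf_pair intro!: sum.cong)
  also have "\<dots> = (\<Sum>a\<in>set_pmf p. (\<Sum>b\<in>set_pmf q. f (a, b) * pmf q b) * pmf p a)"
    by (simp add: sum_distrib_left sum_distrib_right mult_ac)
  also have "\<dots> = (\<Sum>a\<in>set_pmf p. measure_pmf.expectation q (\<lambda>b. f (a, b)) * pmf p a)"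
    using assms by (intro sum.cong refl arg_cong2[where f = "(*)"] integral_measure_pmf_real[symmetric]) auto
  also have "\<dots> = measure_pmf.expectation p (\<lambda>a. measure_pmf.expectation q (\<lambda>b. f (a, b)))"
    using assms by (intro integral_measure_pmf_real[symmetric]) auto
  finally show ?thesis .
qed

text \<open>A crude form of Hoeffding's lemma. The deviation from the mean is at most
  \<open>c \<le> 1\<close>, so \<open>exp_le_quadratic\<close> applies pointwise; after integration
  its linear term vanishes and its quadratic term is at most \<open>c^2\<close>.\<close>

lemma expectation_exp_le:
  fixes F :: "'a \<Rightarrow> real"
  assumes fin: "finite (set_pmf p)" and c: "0 \<le> c" "c \<le> 1"
    and osc: "\<And>x y. \<bar>F x - F y\<bar> \<le> c"
  shows "measure_pmf.expectation p (\<lambda>x. exp (F x)) \<le> exp (measure_pmf.expectation p F + c\<^sup>2)"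
proof -
  have int: "integrable (measure_pmf p) g" for g :: "'a \<Rightarrow> real"
    using fin by (rule integrable_measure_pmf_finite)
  define \<mu> where "\<mu> = measure_pmf.expectation p F"
  have dev: "\<bar>F x - \<mu>\<bar> \<le> c" for x
  proof -
    have "F x - c \<le> \<mu>"
      unfolding \<mu>_def using osc[of x] by (intro measure_pmf.integral_ge_const int AE_I2) (smt (verit))
    moreover have "\<mu> \<le> F x + c"
      unfolding \<mu>_def using osc[of x] by (intro measure_pmf.integral_le_const int AE_I2) (smt (verit))
    ultimately show ?thesis by linarith
  qed
  have pt: "exp (F x) \<le> exp \<mu> * (1 + c\<^sup>2 + (F x - \<mu>))" for x
  proof -
    have "exp (F x - \<mu>) \<le> 1 + (F x - \<mu>) + (F x - \<mu>)\<^sup>2"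
      using dev[of x] c by (intro exp_le_quadratic) linarith
    also have "(F x - \<mu>)\<^sup>2 \<le> c\<^sup>2"
      using dev[of x] c by (simp flip: abs_le_square_iff)
    finally have "exp \<mu> * exp (F x - \<mu>) \<le> exp \<mu> * (1 + c\<^sup>2 + (F x - \<mu>))"
      by (intro mult_left_mono) auto
    then show ?thesis by (simp flip: exp_add)
  qed
  have "measure_pmf.expectation p (\<lambda>x. exp (F x)) \<le>
      measure_pmf.expectation p (\<lambda>x. exp \<mu> * (1 + c\<^sup>2 + (F x - \<mu>)))"
    by (intro integral_mono int pt)
  also have "\<dots> = exp \<mu> * (1 + c\<^sup>2)"
    by (simp add: int \<mu>_def)
  also have "\<dots> \<le> exp \<mu> * exp (c\<^sup>2)"
    by (intro mult_left_mono) (auto simp: exp_ge_add_one_self)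
  finally show ?thesis by (simp add: exp_add \<mu>_def)
qed

lemma finite_set_Pi_pmf:
  assumes "finite A" "\<And>x. x \<in> A \<Longrightarrow> finite (set_pmf (q x))"
  shows "finite (set_pmf (Pi_pmf A dflt q))"
  using assms by (auto simp: set_Pi_pmf intro!: finite_PiE_dflt)

text \<open>The blocks are revealed one at a time, and each contributes a factor \<open>exp (c\<^sup>2)\<close>.\<close>

lemma bounded_differences_exp_moment:
  fixes f :: "('b \<Rightarrow> 'c) \<Rightarrow> real" and dflt :: 'c
  assumes "finite I" and "\<And>i. i \<in> I \<Longrightarrow> finite (B i)" and "disjoint_family_on B I"
    and q: "\<And>x. finite (set_pmf (q x))" and c: "0 \<le> c" "c \<le> 1"
    and "\<And>i g g'. i \<in> I \<Longrightarrow> (\<And>x. x \<notin> B i \<Longrightarrow> g x = g' x) \<Longrightarrow> \<bar>f g - f g'\<bar> \<le> c"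
  defines "P \<equiv> Pi_pmf (\<Union>i\<in>I. B i) dflt q"
  shows "measure_pmf.expectation P (\<lambda>g. exp (f g)) \<le>
    exp (measure_pmf.expectation P f + real (card I) * c\<^sup>2)"
  using assms(1-3,7) unfolding P_def
proof (induction I arbitrary: f rule: finite_induct)
  case empty
  then show ?case by simp
next
  case (insert j I)
  define A where "A = (\<Union>i\<in>I. B i)"
  define Q where "Q = Pi_pmf A dflt q"
  define R where "R = Pi_pmf (B j) dflt q"
  define m where "m = (\<lambda>g h x. if x \<in> B j then h x else g x :: 'c)"
  \<comment> \<open>\<open>F h\<close> is the conditional mean of \<open>f\<close> given the values
    \<open>h\<close> on block \<open>j\<close>. Averaging preserves the oscillation bound, so
    \<open>expectation_exp_le\<close> treats \<open>F\<close>, while the induction hypothesis treats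
    the other blocks with \<open>h\<close> frozen.\<close>
  define F where "F = (\<lambda>h. measure_pmf.expectation Q (\<lambda>g. f (m g h)))"
  have finA: "finite A" and finB: "finite (B j)"
    using insert.hyps insert.prems(1) by (auto simp: A_def)
  have finQ: "finite (set_pmf Q)" and finR: "finite (set_pmf R)"
    unfolding Q_def R_def using finA finB q by (auto intro!: finite_set_Pi_pmf)
  have int: "integrable (measure_pmf Q) k" "integrable (measure_pmf R) k" for k :: "('b \<Rightarrow> 'c) \<Rightarrow> real"
    using finQ finR by (auto intro: integrable_measure_pmf_finite)
  have disj: "B j \<inter> A = {}" and disjI: "disjoint_family_on B I"
    using insert.prems(2) insert.hyps(2) by (auto simp: disjoint_family_on_def A_def)
  have E: "measure_pmf.expectation (Pi_pmf (\<Union>i\<in>insert j I. B i) dflt q) k =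
      measure_pmf.expectation R (\<lambda>h. measure_pmf.expectation Q (\<lambda>g. k (m g h)))"
    for k :: "('b \<Rightarrow> 'c) \<Rightarrow> real"
  proof -
    have "Pi_pmf (\<Union>i\<in>insert j I. B i) dflt q = Pi_pmf (B j \<union> A) dflt q"
      by (simp add: A_def)
    also have "\<dots> = map_pmf (\<lambda>(h, g). m g h) (pair_pmf R Q)"
      unfolding R_def Q_def m_def using finB finA disj by (rule Pi_pmf_union)
    finally show ?thesis
      by (simp add: expectation_pair_pmf_finite[OF finR finQ] case_prod_unfold)
  qed
  have step: "measure_pmf.expectation Q (\<lambda>g. exp (f (m g h))) \<le> exp (F h + real (card I) * c\<^sup>2)" for h
    unfolding F_def Q_def A_def
  proof (rule insert.IH)
    show "finite (B i)" if "i \<in> I" for i using that insert.prems(1) by auto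
    show "disjoint_family_on B I" by (rule disjI)
    show "\<bar>f (m g h) - f (m g' h)\<bar> \<le> c" if "i \<in> I" "\<And>x. x \<notin> B i \<Longrightarrow> g x = g' x" for i g g'
      using that by (intro insert.prems(3)[of i]) (auto simp: m_def)
  qed
  have osc: "\<bar>F h - F h'\<bar> \<le> c" for h h'
  proof -
    have "\<bar>F h - F h'\<bar> = \<bar>measure_pmf.expectation Q (\<lambda>g. f (m g h) - f (m g h'))\<bar>"
      by (simp add: F_def int)
    also have "\<dots> \<le> measure_pmf.expectation Q (\<lambda>g. \<bar>f (m g h) - f (m g h')\<bar>)"
      using integral_norm_bound[of "measure_pmf Q"] by simp
    also have "\<dots> \<le> c"
      by (intro measure_pmf.integral_le_const int AE_I2 insert.prems(3)[of j]) (auto simp: m_def)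
    finally show ?thesis .
  qed
  have "measure_pmf.expectation (Pi_pmf (\<Union>i\<in>insert j I. B i) dflt q) (\<lambda>g. exp (f g)) \<le>
      measure_pmf.expectation R (\<lambda>h. exp (F h + real (card I) * c\<^sup>2))"
    unfolding E by (intro integral_mono int step)
  also have "\<dots> = exp (real (card I) * c\<^sup>2) * measure_pmf.expectation R (\<lambda>h. exp (F h))"
    by (simp add: exp_add mult.commute)
  also have "\<dots> \<le> exp (real (card I) * c\<^sup>2) * exp (measure_pmf.expectation R F + c\<^sup>2)"
    using c osc finR by (intro mult_left_mono expectation_exp_le) auto
  also have "\<dots> = exp (measure_pmf.expectation R F + real (card (insert j I)) * c\<^sup>2)"
    using insert.hyps by (simp add: algebra_simps flip: exp_add)
  finally show ?case unfolding E F_def .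
qed

section \<open>The volume of the boxed polytope\<close>

definition boxed_polytope :: "real \<Rightarrow> 'a set \<Rightarrow> 'a set set \<Rightarrow> ('a \<Rightarrow> real) set" where
  "boxed_polytope a V E =
     {x \<in> V \<rightarrow>\<^sub>E {- (1 / 2 + a)..1 / 2 + a}. \<forall>u v. {u, v} \<in> E \<longrightarrow> \<bar>x u - x v\<bar> \<le> 1}"

definition box_volume :: "real \<Rightarrow> 'a set \<Rightarrow> 'a set set \<Rightarrow> real" where
  "box_volume a V E = measure (\<Pi>\<^sub>M v \<in> V. lborel) (boxed_polytope a V E)"

interpretation lborel_product: product_sigma_finite "\<lambda>_ :: 'a. lborel :: real measure"
  by standard

lemma edge_mem_vertices:
  assumes "E \<subseteq> all_edges V" "{u, v} \<in> E"
  shows "u \<in> V" "v \<in> V" "u \<noteq> v"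
  using assms by (force simp: all_edges_def)+

lemma box_measurable:
  assumes "finite V"
  shows "(V \<rightarrow>\<^sub>E {- (1 / 2 + a)..1 / 2 + a :: real}) \<in> sets (\<Pi>\<^sub>M v \<in> V. lborel)"
  using assms by (intro sets_PiM_I_finite) auto

lemma boxed_polytope_measurable [measurable]:
  assumes V: "finite V" and E: "E \<subseteq> all_edges V"
  shows "boxed_polytope a V E \<in> sets (\<Pi>\<^sub>M v \<in> V. lborel)"
proof -
  let ?M = "\<Pi>\<^sub>M v \<in> V. (lborel :: real measure)"
  \<comment> \<open>The quantifier over all vertices is cut down to finitely many ordered pairs, so
    measurability becomes that of a finite intersection.\<close>
  have "boxed_polytope a V E = (V \<rightarrow>\<^sub>E {- (1 / 2 + a)..1 / 2 + a}) \<inter>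
      {x \<in> space ?M. \<forall>p \<in> {(u, v). {u, v} \<in> E} \<inter> V \<times> V. \<bar>x (fst p) - x (snd p)\<bar> \<le> 1}"
    (is "_ = ?B \<inter> ?C")
  proof (intro equalityI subsetI)
    fix x assume "x \<in> boxed_polytope a V E"
    then show "x \<in> ?B \<inter> ?C" by (auto simp: boxed_polytope_def space_PiM)
  next
    fix x assume x: "x \<in> ?B \<inter> ?C"
    have "\<bar>x u - x v\<bar> \<le> 1" if "{u, v} \<in> E" for u v
    proof -
      have "(u, v) \<in> {(u, v). {u, v} \<in> E} \<inter> V \<times> V" using edge_mem_vertices[OF E that] that by simp
      moreover have "\<forall>p \<in> {(u, v). {u, v} \<in> E} \<inter> V \<times> V. \<bar>x (fst p) - x (snd p)\<bar> \<le> 1"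
        using x by blast
      ultimately show ?thesis by (metis fst_conv snd_conv)
    qed
    then show "x \<in> boxed_polytope a V E" using x by (simp add: boxed_polytope_def)
  qed
  moreover have "{x \<in> space ?M. \<forall>p \<in> {(u, v). {u, v} \<in> E} \<inter> V \<times> V. \<bar>x (fst p) - x (snd p)\<bar> \<le> 1} \<in> sets ?M"
  proof (intro sets.sets_Collect_finite_All)
    show "finite ({(u, v). {u, v} \<in> E} \<inter> V \<times> V)" using V by blast
    fix p assume "p \<in> {(u, v). {u, v} \<in> E} \<inter> V \<times> V"
    then have "(\<lambda>x. x (fst p)) \<in> borel_measurable ?M" "(\<lambda>x. x (snd p)) \<in> borel_measurable ?M"
      using measurable_component_singleton[of "fst p" V "\<lambda>_. lborel :: real measure"]
        measurable_component_singleton[of "snd p" V "\<lambda>_. lborel :: real measure"] by auto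
    then show "{x \<in> space ?M. \<bar>x (fst p) - x (snd p)\<bar> \<le> 1} \<in> sets ?M" by measurable
  qed
  ultimately show ?thesis using box_measurable[OF V, of a] by auto
qed

lemma emeasure_box:
  assumes "finite V" "a \<ge> 0"
  shows "emeasure (\<Pi>\<^sub>M v \<in> V. lborel) (V \<rightarrow>\<^sub>E {- (1 / 2 + a)..1 / 2 + a}) = ennreal ((1 + 2 * a) ^ card V)"
proof -
  have "emeasure lborel {- (1 / 2 + a)..1 / 2 + a} = ennreal (1 + 2 * a)"
    using assms(2) by simp
  then show ?thesis
    using assms by (subst lborel_product.emeasure_PiM) (auto simp: ennreal_power simp del: ennreal_plus emeasure_lborel_Icc)
qed

lemma emeasure_boxed_polytope:
  assumes V: "finite V" and a: "a \<ge> 0"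
  shows "emeasure (\<Pi>\<^sub>M v \<in> V. lborel) (boxed_polytope a V E) = ennreal (box_volume a V E)"
proof -
  have "emeasure (\<Pi>\<^sub>M v \<in> V. lborel) (boxed_polytope a V E) \<le>
      emeasure (\<Pi>\<^sub>M v \<in> V. lborel) (V \<rightarrow>\<^sub>E {- (1 / 2 + a)..1 / 2 + a})"
    using box_measurable[OF V] by (intro emeasure_mono) (auto simp: boxed_polytope_def)
  then have "emeasure (\<Pi>\<^sub>M v \<in> V. lborel) (boxed_polytope a V E) \<noteq> \<infinity>"
    using emeasure_box[OF V a] by (auto simp: top_unique)
  then show ?thesis unfolding box_volume_def by (intro emeasure_eq_ennreal_measure) auto
qed

lemma box_volume_ge_one:
  assumes V: "finite V" and E: "E \<subseteq> all_edges V" and a: "a \<ge> 0"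
  shows "box_volume a V E \<ge> 1"
proof -
  \<comment> \<open>The unit cube respects every possible edge. The bounds are written with
    \<open>+ 0\<close> so that \<open>emeasure_box\<close> at \<open>a = 0\<close> gives its
    volume.\<close>
  have "(V \<rightarrow>\<^sub>E {- (1 / 2 + 0)..1 / 2 + 0}) \<subseteq> boxed_polytope a V E"
  proof
    fix x :: "'a \<Rightarrow> real" assume x: "x \<in> V \<rightarrow>\<^sub>E {- (1 / 2 + 0)..1 / 2 + 0}"
    then have "x v \<in> {- (1 / 2)..1 / 2}" if "v \<in> V" for v using that by auto
    then have xv: "- (1 / 2) \<le> x v" "x v \<le> 1 / 2" if "v \<in> V" for v using that by auto
    have "\<bar>x u - x v\<bar> \<le> 1" if "{u, v} \<in> E" for u v
      using edge_mem_vertices[OF E that] xv[of u] xv[of v] by linarith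
    moreover have "x \<in> V \<rightarrow>\<^sub>E {- (1 / 2 + a)..1 / 2 + a}"
      using x xv a by (force simp: PiE_iff)
    ultimately show "x \<in> boxed_polytope a V E" by (simp add: boxed_polytope_def)
  qed
  then have "ennreal 1 \<le> ennreal (box_volume a V E)"
    unfolding emeasure_boxed_polytope[OF V a, symmetric]
    using emeasure_box[OF V, of 0] boxed_polytope_measurable[OF V E]
    by (metis emeasure_mono mult_zero_right order_refl power_one add_0_right)
  moreover have "box_volume a V E \<ge> 0" by (simp add: box_volume_def)
  ultimately show ?thesis by simp
qed

text \<open>Fubini in the coordinate of \<open>i\<close>. This coordinate stays in a window of
  length \<open>1 + 2 * a\<close>; conversely each value within \<open>1 / 2 - a\<close> of the
  centre is at distance at most \<open>(1 / 2 - a) + (1 / 2 + a) = 1\<close> from the whole window,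
  hence violates no edge at \<open>i\<close>.\<close>

lemma box_volume_delete_vertex:
  assumes V: "finite V" and E: "E \<subseteq> all_edges V" and i: "i \<in> V" and a: "0 \<le> a" "a < 1 / 2"
  defines "Z' \<equiv> box_volume a (V - {i}) {e \<in> E. i \<notin> e}"
  shows "box_volume a V E \<le> (1 + 2 * a) * Z'" and "(1 - 2 * a) * Z' \<le> box_volume a V E"
proof -
  define I where "I = V - {i}"
  define E' where "E' = {e \<in> E. i \<notin> e}"
  have I: "finite I" "i \<notin> I" "V = insert i I" using V i by (auto simp: I_def)
  have E': "E' \<subseteq> all_edges I" using E by (auto simp: E'_def all_edges_def I_def)
  have meas: "indicator (boxed_polytope a V E) \<in> borel_measurable (\<Pi>\<^sub>M v \<in> insert i I. (lborel :: real measure))"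
    using boxed_polytope_measurable[OF V E, of a] I by (intro borel_measurable_indicator) auto
  have meas': "boxed_polytope a I E' \<in> sets (\<Pi>\<^sub>M v \<in> I. lborel)"
    using boxed_polytope_measurable[OF I(1) E'] .
  have Z: "ennreal (box_volume a V E) =
      (\<integral>\<^sup>+x. \<integral>\<^sup>+y. indicator (boxed_polytope a V E) (x(i := y)) \<partial>lborel \<partial>(\<Pi>\<^sub>M v \<in> I. lborel))"
    using lborel_product.product_nn_integral_insert[OF I(1,2) meas] boxed_polytope_measurable[OF V E, of a]
      emeasure_boxed_polytope[OF V a(1), of E] I(3) by simp
  have Z': "(\<integral>\<^sup>+x. \<integral>\<^sup>+y. indicator (boxed_polytope a I E') x * indicator {- s..s} y \<partial>lborel \<partial>(\<Pi>\<^sub>M v \<in> I. lborel)) =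
      ennreal (2 * s * Z')" if "s \<ge> 0" for s :: real
  proof -
    have "(\<integral>\<^sup>+x. \<integral>\<^sup>+y. indicator (boxed_polytope a I E') x * indicator {- s..s} y \<partial>lborel \<partial>(\<Pi>\<^sub>M v \<in> I. lborel)) =
        (\<integral>\<^sup>+x. indicator (boxed_polytope a I E') x * ennreal (2 * s) \<partial>(\<Pi>\<^sub>M v \<in> I. lborel))"
      using that by (simp add: nn_integral_cmult)
    also have "\<dots> = ennreal Z' * ennreal (2 * s)"
      using meas' emeasure_boxed_polytope[OF I(1) a(1), of E']
      by (simp add: nn_integral_multc Z'_def I_def E'_def)
    finally show ?thesis using that by (simp add: ennreal_mult'' mult.commute)
  qed
  have Z'_nonneg: "Z' \<ge> 0" by (simp add: Z'_def box_volume_def)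
  have upper: "x \<in> boxed_polytope a I E' \<and> y \<in> {- (1 / 2 + a)..1 / 2 + a}"
    if x: "x \<in> space (\<Pi>\<^sub>M v \<in> I. lborel)" and xy: "x(i := y) \<in> boxed_polytope a V E" for x :: "'a \<Rightarrow> real" and y
  proof -
    have xyV: "x(i := y) \<in> V \<rightarrow>\<^sub>E {- (1 / 2 + a)..1 / 2 + a}"
      and ed: "\<And>u v. {u, v} \<in> E \<Longrightarrow> \<bar>(x(i := y)) u - (x(i := y)) v\<bar> \<le> 1"
      using xy unfolding boxed_polytope_def by blast+
    have mem: "(x(i := y)) v \<in> {- (1 / 2 + a)..1 / 2 + a}" if "v \<in> V" for v
      using xyV that by (rule PiE_mem)
    have "x \<in> I \<rightarrow>\<^sub>E {- (1 / 2 + a)..1 / 2 + a}"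
    proof (rule PiE_I)
      show "x v \<in> {- (1 / 2 + a)..1 / 2 + a}" if "v \<in> I" for v
        using mem[of v] that I(2,3) by (cases "v = i") auto
      show "x v = undefined" if "v \<notin> I" for v
        using x that by (auto simp: space_PiM PiE_def extensional_def)
    qed
    moreover have "\<bar>x u - x v\<bar> \<le> 1" if "{u, v} \<in> E'" for u v
      using ed[of u v] that by (auto simp: E'_def)
    ultimately show ?thesis using mem[of i] i by (simp add: boxed_polytope_def)
  qed
  have lower: "x(i := y) \<in> boxed_polytope a V E"
    if x: "x \<in> boxed_polytope a I E'" and y: "y \<in> {- (1 / 2 - a)..1 / 2 - a}" for x :: "'a \<Rightarrow> real" and y
  proof -
    have xI: "x \<in> I \<rightarrow>\<^sub>E {- (1 / 2 + a)..1 / 2 + a}"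
      and ed: "\<And>u v. {u, v} \<in> E' \<Longrightarrow> \<bar>x u - x v\<bar> \<le> 1"
      using x unfolding boxed_polytope_def by blast+
    have mem: "- (1 / 2 + a) \<le> x v" "x v \<le> 1 / 2 + a" if "v \<in> I" for v
      using PiE_mem[OF xI that] by auto
    have y': "- (1 / 2 - a) \<le> y" "y \<le> 1 / 2 - a" using y by auto
    have near: "\<bar>y - x v\<bar> \<le> 1" if "v \<in> I" for v
      using mem[OF that] y' by linarith
    have "\<bar>(x(i := y)) u - (x(i := y)) v\<bar> \<le> 1" if e: "{u, v} \<in> E" for u v
    proof -
      note uv = edge_mem_vertices[OF E e]
      consider "u = i" "v \<in> I" | "v = i" "u \<in> I" | "u \<noteq> i" "v \<noteq> i" using uv I(3) by blast
      then show ?thesis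
      proof cases
        case 1 then show ?thesis using near[of v] I(2) by auto
      next
        case 2 then show ?thesis using near[of u] I(2) by (auto simp: abs_minus_commute)
      next
        case 3 then show ?thesis using ed[of u v] e by (auto simp: E'_def)
      qed
    qed
    moreover have "x(i := y) \<in> V \<rightarrow>\<^sub>E {- (1 / 2 + a)..1 / 2 + a}"
      unfolding I(3) using xI y' a by (intro PiE_fun_upd) auto
    ultimately show ?thesis by (simp add: boxed_polytope_def)
  qed
  have "ennreal (box_volume a V E) \<le> ennreal (2 * (1 / 2 + a) * Z')"
    unfolding Z using a
    by (subst Z'[symmetric], simp) (intro nn_integral_mono, use upper in \<open>auto split: split_indicator\<close>)
  then show "box_volume a V E \<le> (1 + 2 * a) * Z'"
    using Z'_nonneg a by (subst (asm) ennreal_le_iff) (simp_all add: algebra_simps)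
  have "ennreal (2 * (1 / 2 - a) * Z') \<le> ennreal (box_volume a V E)"
    unfolding Z using a
    by (subst Z'[symmetric], simp) (intro nn_integral_mono, use lower in \<open>auto split: split_indicator\<close>)
  moreover have "box_volume a V E \<ge> 0" by (simp add: box_volume_def)
  ultimately show "(1 - 2 * a) * Z' \<le> box_volume a V E"
    by (simp add: algebra_simps)
qed

text \<open>Both volumes are compared with the one left after deleting \<open>i\<close>, which is
  the same for \<open>E\<close> and \<open>F\<close>. Their ratio is at most
  \<open>(1 + 2 * a) / (1 - 2 * a)\<close>, and for \<open>a \<le> 1 / 4\<close> this is at most
  \<open>1 + 8 * a \<le> exp (8 * a)\<close>.\<close>

lemma ln_box_volume_vertex_change:
  assumes V: "finite V" and E: "E \<subseteq> all_edges V" and F: "F \<subseteq> all_edges V" and i: "i \<in> V"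
    and EF: "{e \<in> E. i \<notin> e} = {e \<in> F. i \<notin> e}" and a: "0 \<le> a" "a \<le> 1 / 4"
  shows "\<bar>ln (box_volume a V E) - ln (box_volume a V F)\<bar> \<le> 8 * a"
proof -
  have half: "ln (box_volume a V E) - ln (box_volume a V F) \<le> 8 * a"
    if E: "E \<subseteq> all_edges V" and F: "F \<subseteq> all_edges V" and EF: "{e \<in> E. i \<notin> e} = {e \<in> F. i \<notin> e}" for E F
  proof -
    have a': "a < 1 / 2" using a by simp
    let ?Z = "box_volume a (V - {i}) {e \<in> F. i \<notin> e}"
    have 1: "box_volume a V E \<le> (1 + 2 * a) * ?Z"
      using box_volume_delete_vertex(1)[OF V E i a(1) a'] EF by simp
    have 2: "(1 - 2 * a) * ?Z \<le> box_volume a V F"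
      using box_volume_delete_vertex(2)[OF V F i a(1) a'] .
    have Z: "?Z \<ge> 0" by (simp add: box_volume_def)
    have pos: "box_volume a V E \<ge> 1" "box_volume a V F \<ge> 1"
      using box_volume_ge_one[OF V _ a(1)] E F by blast+
    have "1 + 2 * a \<le> (1 + 8 * a) * (1 - 2 * a)"
      using mult_left_mono[OF a(2), of "16 * a"] a by (simp add: algebra_simps)
    then have "(1 + 2 * a) * ?Z \<le> (1 + 8 * a) * ((1 - 2 * a) * ?Z)"
      using Z by (simp add: mult_right_mono flip: mult.assoc)
    also have "\<dots> \<le> (1 + 8 * a) * box_volume a V F"
      using 2 a by (intro mult_left_mono) auto
    also have "\<dots> \<le> exp (8 * a) * box_volume a V F"
      using pos by (intro mult_right_mono) (auto simp: exp_ge_add_one_self)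
    finally have "ln (box_volume a V E) \<le> ln (exp (8 * a) * box_volume a V F)"
      using 1 pos by (intro ln_mono) auto
    also have "\<dots> = 8 * a + ln (box_volume a V F)"
      using pos by (subst ln_mult) auto
    finally show ?thesis by simp
  qed
  show ?thesis using half[OF E F EF] half[OF F E EF[symmetric]] by linarith
qed

section \<open>Comparison with the rooted polytope\<close>

lemma lborel_product_translate:
  fixes t :: "'a \<Rightarrow> real"
  assumes W: "finite W"
  shows "distr (\<Pi>\<^sub>M v \<in> W. lborel) (\<Pi>\<^sub>M v \<in> W. lborel) (\<lambda>y. \<lambda>v\<in>W. y v - t v) = (\<Pi>\<^sub>M v \<in> W. lborel)"
    (is "distr ?M ?M ?s = ?M")
proof (rule lborel_product.PiM_eqI[OF W])
  fix A :: "'a \<Rightarrow> real set" assume A: "\<And>v. v \<in> W \<Longrightarrow> A v \<in> sets lborel"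
  have s: "?s \<in> measurable ?M ?M" by measurable
  have meas: "(\<lambda>y. y - t v) -` A v \<in> sets lborel" if "v \<in> W" for v
  proof -
    have "(\<lambda>y. y - t v) \<in> borel_measurable borel" by measurable
    then show ?thesis using measurable_sets[of "\<lambda>y. y - t v" borel borel "A v"] A[OF that] by simp
  qed
  have "emeasure (distr ?M ?M ?s) (Pi\<^sub>E W A) = emeasure ?M (?s -` Pi\<^sub>E W A \<inter> space ?M)"
    using s A W by (intro emeasure_distr sets_PiM_I_finite) auto
  also have "?s -` Pi\<^sub>E W A \<inter> space ?M = (\<Pi>\<^sub>E v \<in> W. (\<lambda>y. y - t v) -` A v)"
    by (auto simp: space_PiM PiE_iff)
  also have "emeasure ?M \<dots> = (\<Prod>v\<in>W. emeasure lborel ((\<lambda>y. y - t v) -` A v))"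
    using meas by (intro lborel_product.emeasure_PiM W) auto
  also have "\<dots> = (\<Prod>v\<in>W. emeasure lborel (A v))"
  proof (intro prod.cong refl)
    fix v assume v: "v \<in> W"
    have "emeasure lborel (A v) = emeasure (distr lborel borel ((+) (- t v))) (A v)"
      by (simp only: lborel_distr_plus)
    also have "\<dots> = emeasure lborel ((+) (- t v) -` A v \<inter> space lborel)"
      using A[OF v] by (intro emeasure_distr) auto
    also have "(+) (- t v) -` A v \<inter> space lborel = (\<lambda>y. y - t v) -` A v" by auto
    finally show "emeasure lborel ((\<lambda>y. y - t v) -` A v) = emeasure lborel (A v)" ..
  qed
  finally show "emeasure (distr ?M ?M ?s) (Pi\<^sub>E W A) = (\<Prod>v\<in>W. emeasure lborel (A v))" .
qed simp

lemma root_exists1: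
  assumes R: "is_root_set V E R" and v: "v \<in> V"
  shows "\<exists>!r. r \<in> R \<and> (v, r) \<in> reachable V E"
proof -
  have "reachable V E `` {v} \<in> graph_components V E"
    using v by (auto simp: graph_components_def intro: quotientI)
  then have "\<exists>!r. r \<in> R \<inter> reachable V E `` {v}"
    using R by (auto simp: is_root_set_def)
  then show ?thesis by simp
qed

lemma edge_reachable:
  assumes "E \<subseteq> all_edges V" "{u, v} \<in> E"
  shows "(u, v) \<in> reachable V E"
  using assms edge_mem_vertices[OF assms] by (auto simp: reachable_def)

text \<open>Translating each component so that its root moves to the origin maps the section of the
  boxed polytope over any position of the roots into the rooted polytope.\<close>

lemma box_volume_le_polytope_volume:
  assumes G: "finite_graph V E" and R: "is_root_set V E R" and a: "a \<ge> 0"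
  shows "box_volume a V E \<le> (1 + 2 * a) ^ card R * polytope_volume V E R"
proof -
  have V: "finite V" and E: "E \<subseteq> all_edges V" and RV: "R \<subseteq> V"
    using G R by (auto simp: finite_graph_def is_root_set_def)
  define W where "W = V - R"
  have RW: "R \<inter> W = {}" "finite R" "finite W" "V = R \<union> W"
    using V RV by (auto simp: W_def intro: finite_subset)
  let ?M = "\<Pi>\<^sub>M v \<in> W. (lborel :: real measure)" and ?N = "\<Pi>\<^sub>M v \<in> R. (lborel :: real measure)"
  let ?B = "R \<rightarrow>\<^sub>E {- (1 / 2 + a)..1 / 2 + a}"
  define S where "S = (\<lambda>x. restrict x W) ` graph_polytope V E R"
  have vol: "polytope_volume V E R = measure ?M S"
    by (simp add: polytope_volume_def S_def W_def)
  have pos: "measure ?M S > 0" using polytope_volume_pos[OF G R] vol by simp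
  \<comment> \<open>\<open>measure\<close> is 0 on non-measurable sets and on sets of infinite
    measure, so positivity alone yields measurability and finiteness of \<open>S\<close>.\<close>
  then have S_meas: "S \<in> sets ?M" using measure_notin_sets by force
  have S_fin: "emeasure ?M S = ennreal (measure ?M S)"
    using pos by (intro emeasure_eq_ennreal_measure) (auto simp: measure_def)
  define root where "root v = (THE r. r \<in> R \<and> (v, r) \<in> reachable V E)" for v
  have root: "root v \<in> R" "(v, root v) \<in> reachable V E" if "v \<in> V" for v
    using theI'[OF root_exists1[OF R that]] by (auto simp: root_def)
  have root_eqI: "root v = r" if "v \<in> V" "r \<in> R" "(v, r) \<in> reachable V E" for v r
    using that root_exists1[OF R that(1)] root[OF that(1)] by blast
  have root_root: "root r = r" if "r \<in> R" for r
    using that RV by (intro root_eqI) (auto simp: reachable_def)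
  \<comment> \<open>The ends of an edge share their root, so subtracting the root's coordinate
    throughout a component leaves all edge differences unchanged.\<close>
  have root_edge: "root u = root v" if "{u, v} \<in> E" for u v
  proof -
    have "u \<in> V" "v \<in> V" using edge_mem_vertices[OF E that] by auto
    moreover have "(u, root v) \<in> reachable V E"
      using equiv_reachable[of V E] edge_reachable[OF E that] root(2)[OF \<open>v \<in> V\<close>]
      unfolding equiv_def by (meson transD)
    ultimately show ?thesis using root(1) by (intro root_eqI) auto
  qed
  \<comment> \<open>The indicator on the right records that the roots themselves stay in the window;
    integrating it over the positions of the roots produces the factor
    \<open>(1 + 2 * a) ^ card R\<close>.\<close>
  have section_le: "emeasure ?M ((\<lambda>y. merge R W (x, y)) -` boxed_polytope a V E \<inter> space ?M)
      \<le> emeasure ?M S * indicator ?B x" if x: "x \<in> space ?N" for x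
  proof -
    let ?s = "\<lambda>y. \<lambda>v\<in>W. y v - x (root v)"
    have s: "?s \<in> measurable ?M ?M" by measurable
    have sub: "x \<in> ?B \<and> ?s y \<in> S" if y: "y \<in> space ?M" and z: "merge R W (x, y) \<in> boxed_polytope a V E" for y
    proof -
      let ?z = "merge R W (x, y)"
      have zV: "?z \<in> V \<rightarrow>\<^sub>E {- (1 / 2 + a)..1 / 2 + a}"
        and ed: "\<And>u v. {u, v} \<in> E \<Longrightarrow> \<bar>?z u - ?z v\<bar> \<le> 1"
        using z unfolding boxed_polytope_def by blast+
      have "x \<in> ?B"
      proof (rule PiE_I)
        show "x v \<in> {- (1 / 2 + a)..1 / 2 + a}" if "v \<in> R" for v
          using PiE_mem[OF zV, of v] that RV by (auto simp: merge_def)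
        show "x v = undefined" if "v \<notin> R" for v
          using x that by (auto simp: space_PiM PiE_def extensional_def)
      qed
      moreover have "(\<lambda>v\<in>V. ?z v - x (root v)) \<in> graph_polytope V E R"
        using RV edge_mem_vertices[OF E] root_edge ed
        by (auto simp: graph_polytope_def root_root merge_def)
      moreover have "?s y = restrict (\<lambda>v\<in>V. ?z v - x (root v)) W"
        using RW(4) RW(1) by (auto simp: fun_eq_iff merge_def restrict_def)
      ultimately show ?thesis unfolding S_def by blast
    qed
    show ?thesis
    proof (cases "x \<in> ?B")
      case True
      have "emeasure ?M ((\<lambda>y. merge R W (x, y)) -` boxed_polytope a V E \<inter> space ?M)
          \<le> emeasure ?M (?s -` S \<inter> space ?M)"
        using sub measurable_sets[OF s S_meas] by (intro emeasure_mono) auto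
      also have "\<dots> = emeasure (distr ?M ?M ?s) S"
        using s S_meas by (intro emeasure_distr[symmetric]) auto
      also have "\<dots> = emeasure ?M S"
        using lborel_product_translate[OF RW(3), of "\<lambda>v. x (root v)"] by simp
      finally show ?thesis using True by simp
    next
      case False
      then have "(\<lambda>y. merge R W (x, y)) -` boxed_polytope a V E \<inter> space ?M = {}"
        using sub by blast
      then show ?thesis by simp
    qed
  qed
  have "ennreal (box_volume a V E) = emeasure (\<Pi>\<^sub>M v \<in> R \<union> W. lborel) (boxed_polytope a V E)"
    using emeasure_boxed_polytope[OF V a, of E] RW(4) by simp
  also have "\<dots> = (\<integral>\<^sup>+x. emeasure ?M ((\<lambda>y. merge R W (x, y)) -` boxed_polytope a V E \<inter> space ?M) \<partial>?N)"
    using boxed_polytope_measurable[OF V E] RW by (intro lborel_product.emeasure_fold_integral) auto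
  also have "\<dots> \<le> (\<integral>\<^sup>+x. emeasure ?M S * indicator ?B x \<partial>?N)"
    by (intro nn_integral_mono section_le)
  also have "\<dots> = emeasure ?M S * emeasure ?N ?B"
    using box_measurable[OF RW(2)] by (intro nn_integral_cmult_indicator)
  also have "\<dots> = ennreal (measure ?M S * (1 + 2 * a) ^ card R)"
    unfolding S_fin emeasure_box[OF RW(2) a] using a by (simp add: ennreal_mult)
  finally show ?thesis using a vol by (simp add: mult.commute)
qed

section \<open>The truncated logistic profile\<close>

definition logistic :: "real \<Rightarrow> real" where
  "logistic t = 1 / (1 + exp (- t))"

lemma one_plus_exp_pos [simp]: "1 + exp (t :: real) > 0" "1 + exp t \<noteq> 0"
  using exp_gt_zero[of t] by linarith+

lemma logistic_pos [simp]: "logistic t > 0"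
  by (simp add: logistic_def)

lemma logistic_less_one [simp]: "logistic t < 1"
  by (simp add: logistic_def)

lemma logistic_nonneg [simp]: "logistic t \<ge> 0" and logistic_le_one [simp]: "logistic t \<le> 1"
  by (simp_all add: less_imp_le)

lemma ln_logistic: "ln (logistic t) = - ln (1 + exp (- t))"
  by (simp add: logistic_def ln_div)

lemma has_real_derivative_logistic [derivative_intros]:
  assumes "(g has_real_derivative g') (at x within A)"
  shows "((\<lambda>x. logistic (g x)) has_real_derivative
    logistic (g x) * (1 - logistic (g x)) * g') (at x within A)"
  unfolding logistic_def
  by (rule derivative_eq_intros assms refl | simp)+ (simp add: field_simps power2_eq_square)

lemma has_real_derivative_ln_one_plus_exp:
  assumes "(g has_real_derivative g') (at x within A)"
  shows "((\<lambda>x. ln (1 + exp (g x))) has_real_derivative logistic (g x) * g') (at x within A)"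
  by (rule derivative_eq_intros assms refl | simp)+ (simp add: logistic_def exp_minus field_simps)

lemma logistic_measurable [measurable]: "logistic \<in> borel_measurable borel"
  unfolding logistic_def[abs_def] by measurable

text \<open>Since \<open>ln (1 + exp t)\<close> is an antiderivative of \<open>logistic t\<close>,
  this says that the logistic function has integral \<open>K\<close> over the interval from
  \<open>- K\<close> to \<open>K\<close>, half the length of that interval.\<close>

lemma ln_one_plus_exp_diff: "ln (1 + exp t) - ln (1 + exp (- t)) = (t :: real)"
proof -
  have "1 + exp t = exp t * (1 + exp (- t))"
    by (simp add: algebra_simps flip: exp_add)
  then have "ln (1 + exp t) = ln (exp t * (1 + exp (- t)))" by simp
  also have "\<dots> = t + ln (1 + exp (- t))" by (subst ln_mult) auto
  finally show ?thesis by simp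
qed

text \<open>An antiderivative of \<open>- q ^ n * ln q\<close>, the \<open>n\<close>-th term of the expansion of
  \<open>- ln q / (1 - q)\<close>; its increment over the unit interval is \<open>1 / (n + 1)\<^sup>2\<close>.\<close>

definition dilog_term :: "nat \<Rightarrow> real \<Rightarrow> real" where
  "dilog_term n q = - (q ^ Suc n * ln q) / Suc n + q ^ Suc n / (Suc n)\<^sup>2"

lemma has_real_derivative_dilog_term:
  assumes "q > 0"
  shows "(dilog_term n has_real_derivative - (q ^ n * ln q)) (at q)"
proof -
  define c where "c = real (Suc n)"
  have c: "c > 0" by (simp add: c_def)
  have "((\<lambda>q. (1 / c\<^sup>2) * q ^ Suc n - (1 / c) * (q ^ Suc n * ln q)) has_real_derivative
      (1 / c\<^sup>2) * (c * q ^ n) - (1 / c) * (c * q ^ n * ln q + 1 / q * q ^ Suc n)) (at q)"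
    using DERIV_pow[of "Suc n" q] DERIV_ln_divide[OF assms]
    by (intro DERIV_diff DERIV_cmult DERIV_mult) (simp_all add: c_def)
  moreover have "(1 / c\<^sup>2) * (c * q ^ n) - (1 / c) * (c * q ^ n * ln q + 1 / q * q ^ Suc n) = - (q ^ n * ln q)"
    using assms c by (simp add: field_simps power2_eq_square)
  ultimately show ?thesis by (simp add: dilog_term_def[abs_def] c_def)
qed

lemma dilog_term_logistic_limit:
  "((\<lambda>K. dilog_term n (logistic K) - dilog_term n (logistic (- K))) \<longlongrightarrow> 1 / (real n + 1)\<^sup>2) at_top"
proof -
  have 1: "(logistic \<longlongrightarrow> 1) at_top" unfolding logistic_def[abs_def] by real_asymp
  have 2: "((\<lambda>K. logistic (- K)) \<longlongrightarrow> 0) at_top" unfolding logistic_def[abs_def] by real_asymp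
  \<comment> \<open>\<open>ln q\<close> diverges at the lower end \<open>q = 0\<close>; keeping one
    factor \<open>q\<close> with it makes the limit exist, even for \<open>n = 0\<close>.\<close>
  have 3: "((\<lambda>K. logistic (- K) * ln (logistic (- K))) \<longlongrightarrow> 0) at_top"
    unfolding logistic_def[abs_def] by real_asymp
  have "((\<lambda>K. dilog_term n (logistic K)) \<longlongrightarrow> - (1 ^ Suc n * ln 1) / Suc n + 1 ^ Suc n / (Suc n)\<^sup>2) at_top"
    unfolding dilog_term_def by (intro tendsto_intros 1) auto
  moreover have "((\<lambda>K. - (logistic (- K) ^ n * (logistic (- K) * ln (logistic (- K)))) / Suc n
      + logistic (- K) ^ n * logistic (- K) / (Suc n)\<^sup>2) \<longlongrightarrow> - (0 ^ n * 0) / Suc n + 0 ^ n * 0 / (Suc n)\<^sup>2) at_top"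
    by (intro tendsto_intros 2 3) auto
  then have "((\<lambda>K. dilog_term n (logistic (- K))) \<longlongrightarrow> 0) at_top"
    by (simp add: dilog_term_def mult_ac)
  ultimately have "((\<lambda>K. dilog_term n (logistic K) - dilog_term n (logistic (- K))) \<longlongrightarrow>
      (- (1 ^ Suc n * ln 1) / Suc n + 1 ^ Suc n / (Suc n)\<^sup>2) - 0) at_top"
    by (rule tendsto_diff)
  then show ?thesis by (simp add: add.commute)
qed

text \<open>The Basel series is cut at \<open>N\<close> first and \<open>K\<close> is chosen
  afterwards for a finite sum, so no interchange of limits occurs.\<close>

lemma ex_dilog_sum_ge:
  assumes "\<delta> > 0"
  obtains K N where "K \<ge> 1"
    and "(\<Sum>n<N. dilog_term n (logistic K) - dilog_term n (logistic (- K))) \<ge> pi\<^sup>2 / 6 - \<delta>"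
proof -
  have "(\<lambda>N. \<Sum>n<N. 1 / (real n + 1)\<^sup>2) \<longlonglongrightarrow> pi\<^sup>2 / 6"
    using inverse_squares_sums by (simp add: sums_def add.commute)
  then have "\<forall>\<^sub>F N in sequentially. (\<Sum>n<N. 1 / (real n + 1)\<^sup>2) > pi\<^sup>2 / 6 - \<delta>"
    using assms by (intro order_tendstoD) auto
  then obtain N where N: "(\<Sum>n<N. 1 / (real n + 1)\<^sup>2) > pi\<^sup>2 / 6 - \<delta>"
    by (auto simp: eventually_sequentially)
  have "((\<lambda>K. \<Sum>n<N. dilog_term n (logistic K) - dilog_term n (logistic (- K)))
      \<longlongrightarrow> (\<Sum>n<N. 1 / (real n + 1)\<^sup>2)) at_top"
    by (intro tendsto_sum dilog_term_logistic_limit)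
  then have "\<forall>\<^sub>F K in at_top. (\<Sum>n<N. dilog_term n (logistic K) - dilog_term n (logistic (- K)))
      > pi\<^sup>2 / 6 - \<delta>"
    using N by (intro order_tendstoD) auto
  then have "\<forall>\<^sub>F K in at_top. K \<ge> 1 \<and> (\<Sum>n<N. dilog_term n (logistic K) - dilog_term n (logistic (- K)))
      > pi\<^sup>2 / 6 - \<delta>"
    by (intro eventually_conj eventually_ge_at_top)
  then obtain K where "K \<ge> 1" "(\<Sum>n<N. dilog_term n (logistic K) - dilog_term n (logistic (- K)))
      > pi\<^sup>2 / 6 - \<delta>"
    unfolding eventually_at_top_linorder by blast
  then show thesis by (intro that[of K N]) auto
qed

section \<open>Mass, conflicts and entropy of the truncated profile\<close>

lemma nn_integral_reflect:
  fixes f :: "real \<Rightarrow> ennreal"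
  assumes "f \<in> borel_measurable borel"
  shows "(\<integral>\<^sup>+x. f (- x) \<partial>lborel) = (\<integral>\<^sup>+x. f x \<partial>lborel)"
  using nn_integral_real_affine[OF assms, of "-1" 0] by simp

text \<open>The density is truncated at \<open>\<plusminus>K\<close>; the total mass stays exactly \<open>1\<close>
  because \<open>logistic t + logistic (- t) = 1\<close>.\<close>

definition profile :: "real \<Rightarrow> real \<Rightarrow> real \<Rightarrow> real" where
  "profile d K x = (let t = d * (1 / 2 - \<bar>x\<bar>) in if t < - K then 0 else if t \<le> K then logistic t else 1)"

text \<open>Off the support the value \<open>d\<close> makes the bound \<open>neg_ln_profile d K x / d\<close> on the mass in
  conflict with \<open>x\<close> trivially true.\<close>

definition neg_ln_profile :: "real \<Rightarrow> real \<Rightarrow> real \<Rightarrow> real" where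
  "neg_ln_profile d K x = (if profile d K x = 0 then d else - ln (profile d K x))"

lemma profile_measurable [measurable]: "profile d K \<in> borel_measurable borel"
  unfolding profile_def[abs_def] Let_def by measurable

lemma neg_ln_profile_measurable [measurable]: "neg_ln_profile d K \<in> borel_measurable borel"
  unfolding neg_ln_profile_def[abs_def] by measurable

lemma profile_nonneg [simp]: "profile d K x \<ge> 0" and profile_le_one: "profile d K x \<le> 1"
  by (simp_all add: profile_def Let_def)

lemma profile_minus [simp]: "profile d K (- x) = profile d K x"
  by (simp add: profile_def)

lemma neg_ln_profile_minus [simp]: "neg_ln_profile d K (- x) = neg_ln_profile d K x"
  by (simp add: neg_ln_profile_def)

text \<open>The condition \<open>2 * K < d\<close> makes \<open>a < 1 / 2\<close>, so the boundary
  layers of half-width \<open>a\<close> around \<open>- 1 / 2\<close> and \<open>1 / 2\<close> are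
  disjoint.\<close>

locale truncated_profile =
  fixes d K :: real
  assumes K: "K > 0" and dK: "2 * K < d"
begin

definition a :: real where "a = K / d"

lemma d_pos: "d > 0" and a_pos: "a > 0" and a_less_half: "a < 1 / 2" and d_a: "d * a = K"
  using K dK by (auto simp: a_def field_simps)

lemma scaled_le_iff: "d * (1 / 2 - y) \<le> K \<longleftrightarrow> 1 / 2 - a \<le> y" "- K \<le> d * (1 / 2 - y) \<longleftrightarrow> y \<le> 1 / 2 + a"
proof -
  have "d * (1 / 2 - y) \<le> d * a \<longleftrightarrow> 1 / 2 - y \<le> a" "d * (- a) \<le> d * (1 / 2 - y) \<longleftrightarrow> - a \<le> 1 / 2 - y"
    using d_pos by (simp_all only: mult_le_cancel_left_pos)
  then show "d * (1 / 2 - y) \<le> K \<longleftrightarrow> 1 / 2 - a \<le> y" "- K \<le> d * (1 / 2 - y) \<longleftrightarrow> y \<le> 1 / 2 + a"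
    using d_a by auto
qed

lemma profile_eq:
  "profile d K x = (if 1 / 2 + a < \<bar>x\<bar> then 0 else if 1 / 2 - a \<le> \<bar>x\<bar> then logistic (d * (1 / 2 - \<bar>x\<bar>)) else 1)"
proof -
  have "d * (1 / 2 - \<bar>x\<bar>) < - K \<longleftrightarrow> 1 / 2 + a < \<bar>x\<bar>"
    using scaled_le_iff(2)[of "\<bar>x\<bar>"] by linarith
  then show ?thesis
    unfolding profile_def Let_def using scaled_le_iff(1)[of "\<bar>x\<bar>"] by presburger
qed

lemma profile_eq_0_iff: "profile d K x = 0 \<longleftrightarrow> 1 / 2 + a < \<bar>x\<bar>"
  using logistic_pos[THEN less_imp_neq, of "d * (1 / 2 - \<bar>x\<bar>)"] by (auto simp: profile_eq)

lemma neg_ln_profile_nonneg [simp]: "neg_ln_profile d K x \<ge> 0"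
  using d_pos profile_le_one[of d K x] profile_nonneg[of d K x]
  by (auto simp: neg_ln_profile_def ln_le_zero_iff less_le)

text \<open>Boundedness later supplies integrability, both for the entropy and for the integrand in
  Jensen's inequality.\<close>

lemma neg_ln_profile_bounded: "neg_ln_profile d K x \<le> max d (ln (1 + exp K))"
proof -
  have "ln (1 + exp (- (d * (1 / 2 - \<bar>x\<bar>)))) \<le> ln (1 + exp K)" if "\<bar>x\<bar> \<le> 1 / 2 + a"
  proof -
    have "- (d * (1 / 2 - \<bar>x\<bar>)) \<le> K" using that scaled_le_iff(2)[of "\<bar>x\<bar>"] by linarith
    then show ?thesis by simp
  qed
  moreover have "ln (1 + exp K) \<ge> 0" by simp
  ultimately show ?thesis
    unfolding neg_ln_profile_def profile_eq_0_iff by (auto simp: profile_eq ln_logistic le_max_iff_disj)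
qed

lemma logistic_integral_right:
  assumes "u \<le> v"
  shows "(\<integral>\<^sup>+x. ennreal (logistic (d * (1 / 2 - x))) * indicator {u..v} x \<partial>lborel) =
    ennreal ((ln (1 + exp (d * (1 / 2 - u))) - ln (1 + exp (d * (1 / 2 - v)))) / d)"
proof -
  let ?F = "\<lambda>x. - ln (1 + exp (d * (1 / 2 - x))) / d"
  have "(\<integral>\<^sup>+x. ennreal (logistic (d * (1 / 2 - x))) * indicator {u..v} x \<partial>lborel) = ennreal (?F v - ?F u)"
  proof (rule nn_integral_FTC_Icc)
    show "(?F has_real_derivative logistic (d * (1 / 2 - x))) (at x)" for x
      by (rule derivative_eq_intros has_real_derivative_ln_one_plus_exp refl | simp)+
        (use d_pos in auto)
  qed (use assms in auto)
  then show ?thesis by (simp add: diff_divide_distrib)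
qed

text \<open>Each boundary layer has length \<open>2 * a\<close> and, by the symmetry of the logistic
  function, mass \<open>a\<close>; the flat part between them has density 1 and length
  \<open>1 - 2 * a\<close>.\<close>

lemma profile_mass: "(\<integral>\<^sup>+x. ennreal (profile d K x) \<partial>lborel) = 1"
proof -
  let ?r = "\<lambda>x. ennreal (logistic (d * (1 / 2 - x))) * indicator {1 / 2 - a..1 / 2 + a} x"
  \<comment> \<open>With closed layers and an open flat part the decomposition holds at every point,
    not just almost everywhere.\<close>
  have "ennreal (profile d K x) = ?r x + ?r (- x) + indicator {- (1 / 2 - a)<..<1 / 2 - a} x" for x
  proof -
    consider "1 / 2 + a < \<bar>x\<bar>" | "1 / 2 - a \<le> x" "x \<le> 1 / 2 + a" | "1 / 2 - a \<le> - x" "- x \<le> 1 / 2 + a"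
      | "\<bar>x\<bar> < 1 / 2 - a" by linarith
    then show ?thesis
    proof cases
      case 1
      then have "x \<notin> {1 / 2 - a..1 / 2 + a}" "- x \<notin> {1 / 2 - a..1 / 2 + a}" "x \<notin> {- (1 / 2 - a)<..<1 / 2 - a}"
        using a_pos unfolding atLeastAtMost_iff greaterThanLessThan_iff by linarith+
      moreover have "profile d K x = 0" using 1 by (simp only: profile_eq_0_iff)
      ultimately show ?thesis by (simp del: atLeastAtMost_iff greaterThanLessThan_iff)
    next
      case 2
      then have "x \<in> {1 / 2 - a..1 / 2 + a}" "- x \<notin> {1 / 2 - a..1 / 2 + a}" "x \<notin> {- (1 / 2 - a)<..<1 / 2 - a}"
        and "\<bar>x\<bar> = x"
        using a_less_half unfolding atLeastAtMost_iff greaterThanLessThan_iff by linarith+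
      moreover have "profile d K x = logistic (d * (1 / 2 - x))"
        using 2 \<open>\<bar>x\<bar> = x\<close> by (simp add: profile_eq)
      ultimately show ?thesis by (simp del: atLeastAtMost_iff greaterThanLessThan_iff)
    next
      case 3
      then have "x \<notin> {1 / 2 - a..1 / 2 + a}" "- x \<in> {1 / 2 - a..1 / 2 + a}" "x \<notin> {- (1 / 2 - a)<..<1 / 2 - a}"
        and "\<bar>x\<bar> = - x"
        using a_less_half unfolding atLeastAtMost_iff greaterThanLessThan_iff by linarith+
      moreover have "profile d K x = logistic (d * (1 / 2 - (- x)))"
        using 3 \<open>\<bar>x\<bar> = - x\<close> by (simp add: profile_eq)
      ultimately show ?thesis by (simp del: atLeastAtMost_iff greaterThanLessThan_iff)
    next
      case 4
      then have "x \<notin> {1 / 2 - a..1 / 2 + a}" "- x \<notin> {1 / 2 - a..1 / 2 + a}" "x \<in> {- (1 / 2 - a)<..<1 / 2 - a}"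
        and "\<not> 1 / 2 + a < \<bar>x\<bar>" "\<not> 1 / 2 - a \<le> \<bar>x\<bar>"
        using a_pos unfolding atLeastAtMost_iff greaterThanLessThan_iff by linarith+
      moreover have "profile d K x = 1"
        using \<open>\<not> 1 / 2 + a < \<bar>x\<bar>\<close> \<open>\<not> 1 / 2 - a \<le> \<bar>x\<bar>\<close> by (simp only: profile_eq if_False)
      ultimately show ?thesis by (simp del: atLeastAtMost_iff greaterThanLessThan_iff)
    qed
  qed
  then have "(\<integral>\<^sup>+x. ennreal (profile d K x) \<partial>lborel) =
      (\<integral>\<^sup>+x. ?r x + ?r (- x) + indicator {- (1 / 2 - a)<..<1 / 2 - a} x \<partial>lborel)"
    by (rule nn_integral_cong)
  also have "\<dots> = (\<integral>\<^sup>+x. ?r x + ?r (- x) \<partial>lborel) + (\<integral>\<^sup>+x. indicator {- (1 / 2 - a)<..<1 / 2 - a} x \<partial>lborel)"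
    by (rule nn_integral_add) measurable
  also have "(\<integral>\<^sup>+x. ?r x + ?r (- x) \<partial>lborel) = (\<integral>\<^sup>+x. ?r x \<partial>lborel) + (\<integral>\<^sup>+x. ?r (- x) \<partial>lborel)"
    by (rule nn_integral_add) measurable
  also have "(\<integral>\<^sup>+x. indicator {- (1 / 2 - a)<..<1 / 2 - a} x \<partial>lborel) =
      emeasure lborel {- (1 / 2 - a)<..<1 / 2 - a}"
    by (rule nn_integral_indicator) measurable
  also have "(\<integral>\<^sup>+x. ?r (- x) \<partial>lborel) = (\<integral>\<^sup>+x. ?r x \<partial>lborel)"
    by (rule nn_integral_reflect) measurable
  also have "(\<integral>\<^sup>+x. ?r x \<partial>lborel) = ennreal a"
  proof -
    have "d * (1 / 2 - (1 / 2 - a)) = K" "d * (1 / 2 - (1 / 2 + a)) = - K"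
      using d_a by simp_all
    then show ?thesis
      using a_pos ln_one_plus_exp_diff[of K] by (subst logistic_integral_right) (simp_all add: a_def)
  qed
  also have "emeasure lborel {- (1 / 2 - a)<..<1 / 2 - a} = ennreal (1 - 2 * a)"
    using a_less_half by simp
  also have "ennreal a + ennreal a + ennreal (1 - 2 * a) = 1"
    using a_pos a_less_half by (simp flip: ennreal_plus)
  finally show ?thesis .
qed

text \<open>Self-consistency of the profile: up to truncation, \<open>profile d K x\<close> equals
  \<open>exp (- d * m x)\<close>, where \<open>m x\<close> is the mass at distance more than \<open>1\<close> from \<open>x\<close>.\<close>

lemma profile_conflict_mass_le:
  "(\<integral>\<^sup>+y. ennreal (profile d K y) * indicator {y. \<bar>y - x\<bar> > 1} y \<partial>lborel) \<le> ennreal (neg_ln_profile d K x / d)"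
proof -
  \<comment> \<open>The profile is even, so it is enough to treat \<open>x \<le> 0\<close>. The
    cases are \<open>x\<close> off the support, in the flat part, and in the left boundary
    layer.\<close>
  have neg: "(\<integral>\<^sup>+y. ennreal (profile d K y) * indicator {y. \<bar>y - x\<bar> > 1} y \<partial>lborel)
      \<le> ennreal (neg_ln_profile d K x / d)" if x: "x \<le> 0" for x
  proof (cases "\<bar>x\<bar> \<le> 1 / 2 + a")
    case False
    then have "neg_ln_profile d K x / d = 1"
      using d_pos by (simp add: neg_ln_profile_def profile_eq_0_iff)
    moreover have "(\<integral>\<^sup>+y. ennreal (profile d K y) * indicator {y. \<bar>y - x\<bar> > 1} y \<partial>lborel)
        \<le> (\<integral>\<^sup>+y. ennreal (profile d K y) \<partial>lborel)"
      by (intro nn_integral_mono) (auto split: split_indicator)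
    ultimately show ?thesis by (simp add: profile_mass)
  next
    case True
    show ?thesis
    proof (cases "1 / 2 - a \<le> \<bar>x\<bar>")
      case False
      have "(\<integral>\<^sup>+y. ennreal (profile d K y) * indicator {y. \<bar>y - x\<bar> > 1} y \<partial>lborel) =
          (\<integral>\<^sup>+y. 0 \<partial>(lborel :: real measure))"
      proof (intro nn_integral_cong)
        fix y
        have "\<bar>y - x\<bar> \<le> 1 \<or> profile d K y = 0"
          using False unfolding profile_eq_0_iff by linarith
        then show "ennreal (profile d K y) * indicator {y. \<bar>y - x\<bar> > 1} y = 0"
          by (auto simp: indicator_def)
      qed
      then show ?thesis by simp
    next
      case x': True
      have "(\<integral>\<^sup>+y. ennreal (profile d K y) * indicator {y. \<bar>y - x\<bar> > 1} y \<partial>lborel)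
          \<le> (\<integral>\<^sup>+y. ennreal (logistic (d * (1 / 2 - y))) * indicator {1 + x..1 / 2 + a} y \<partial>lborel)"
      proof (intro nn_integral_mono)
        fix y
        show "ennreal (profile d K y) * indicator {y. \<bar>y - x\<bar> > 1} y
            \<le> ennreal (logistic (d * (1 / 2 - y))) * indicator {1 + x..1 / 2 + a} y"
        proof (cases "\<bar>y - x\<bar> > 1 \<and> \<bar>y\<bar> \<le> 1 / 2 + a")
          case y: True
          then have "\<bar>y\<bar> = y" "1 + x \<le> y" "1 / 2 - a \<le> y" "y \<le> 1 / 2 + a"
            using True x x' a_less_half a_pos by linarith+
          then show ?thesis by (simp add: profile_eq indicator_def)
        next
          case False
          then have "\<bar>y - x\<bar> \<le> 1 \<or> profile d K y = 0"
            unfolding profile_eq_0_iff by linarith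
          then show ?thesis by (auto simp: indicator_def)
        qed
      qed
      also have "\<dots> = ennreal ((ln (1 + exp (d * (1 / 2 - (1 + x)))) - ln (1 + exp (d * (1 / 2 - (1 / 2 + a))))) / d)"
        using True x x' by (intro logistic_integral_right) auto
      \<comment> \<open>The discarded term is the logistic tail beyond the cutoff; without it the
        bound is exactly \<open>- ln\<close> of the profile at \<open>x\<close>, divided by
        \<open>d\<close>.\<close>
      also have "\<dots> \<le> ennreal (ln (1 + exp (d * (1 / 2 - (1 + x)))) / d)"
        using d_pos by (intro ennreal_leI divide_right_mono) auto
      also have "ln (1 + exp (d * (1 / 2 - (1 + x)))) = neg_ln_profile d K x"
        using True x x' unfolding neg_ln_profile_def profile_eq_0_iff
        by (auto simp: profile_eq ln_logistic algebra_simps)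
      finally show ?thesis .
    qed
  qed
  show ?thesis
  proof (cases "x \<le> 0")
    case False
    have "(\<integral>\<^sup>+y. ennreal (profile d K y) * indicator {y. \<bar>y - x\<bar> > 1} y \<partial>lborel) =
        (\<integral>\<^sup>+y. ennreal (profile d K (- y)) * indicator {y. \<bar>y - x\<bar> > 1} (- y) \<partial>lborel)"
      by (rule nn_integral_reflect[symmetric]) measurable
    also have "\<dots> = (\<integral>\<^sup>+y. ennreal (profile d K y) * indicator {y. \<bar>y - (- x)\<bar> > 1} y \<partial>lborel)"
      by (intro nn_integral_cong) (auto split: split_indicator)
    also have "\<dots> \<le> ennreal (neg_ln_profile d K (- x) / d)"
      using False by (intro neg) auto
    finally show ?thesis by simp
  qed (rule neg)
qed

text \<open>With \<open>q = logistic (d * (1 / 2 - x))\<close> one has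
  \<open>dq = - d * q * (1 - q) dx\<close>, so the entropy of a layer is the integral of
  \<open>- ln q / (1 - q)\<close>, divided by \<open>d\<close>. Cutting the geometric series for
  \<open>1 / (1 - q)\<close> after \<open>N\<close> terms only lowers it and leaves increments of
  \<open>dilog_term\<close>; the factor 2 counts the layers.\<close>

lemma profile_entropy_ge:
  "(\<integral>\<^sup>+x. ennreal (profile d K x * neg_ln_profile d K x) \<partial>lborel) \<ge>
    ennreal (2 * (\<Sum>n<N. dilog_term n (logistic K) - dilog_term n (logistic (- K))) / d)"
proof -
  define S where "S = (\<Sum>n<N. dilog_term n (logistic K) - dilog_term n (logistic (- K)))"
  define k where "k = (\<lambda>q :: real. \<Sum>n<N. q * (1 - q) * - (q ^ n * ln q))"
  define F where "F = (\<lambda>x. - (\<Sum>n<N. dilog_term n (logistic (d * (1 / 2 - x)))) / d)"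
  let ?r = "\<lambda>x. ennreal (k (logistic (d * (1 / 2 - x)))) * indicator {1 / 2 - a..1 / 2 + a} x"
  have k_le: "k q \<le> q * - ln q" if "0 < q" "q < 1" for q
  proof -
    have "k q = (q * - ln q) * ((1 - q) * (\<Sum>n<N. q ^ n))"
      by (simp add: k_def sum_distrib_left algebra_simps)
    also have "(1 - q) * (\<Sum>n<N. q ^ n) = 1 - q ^ N"
      by (simp add: one_diff_power_eq)
    also have "(q * - ln q) * (1 - q ^ N) \<le> (q * - ln q) * 1"
      using that by (intro mult_left_mono) (auto simp: mult_nonneg_nonpos)
    finally show ?thesis by simp
  qed
  have k_nonneg: "k q \<ge> 0" if "0 < q" "q < 1" for q
    unfolding k_def using that by (intro sum_nonneg mult_nonneg_nonneg) (auto simp: mult_nonneg_nonpos)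
  have [measurable]: "k \<in> borel_measurable borel" unfolding k_def[abs_def] by measurable
  have "(\<integral>\<^sup>+x. ?r x \<partial>lborel) = ennreal (F (1 / 2 + a) - F (1 / 2 - a))"
  proof (rule nn_integral_FTC_Icc)
    fix x
    have "((\<lambda>x. \<Sum>n<N. dilog_term n (logistic (d * (1 / 2 - x)))) has_real_derivative
        (\<Sum>n<N. - (logistic (d * (1 / 2 - x)) ^ n * ln (logistic (d * (1 / 2 - x)))) *
          (logistic (d * (1 / 2 - x)) * (1 - logistic (d * (1 / 2 - x))) * (- d)))) (at x)"
      by (intro DERIV_sum DERIV_chain2[OF has_real_derivative_dilog_term])
        (auto intro!: derivative_eq_intros)
    from DERIV_cdivide[OF DERIV_minus[OF this], of d]
    show "(F has_real_derivative k (logistic (d * (1 / 2 - x)))) (at x)"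
      unfolding F_def k_def
      by (rule DERIV_cong) (use d_pos in \<open>simp add: sum_divide_distrib sum_negf[symmetric] mult_ac\<close>)
  qed (use a_pos in \<open>auto intro: k_nonneg\<close>)
  also have "F (1 / 2 + a) - F (1 / 2 - a) = S / d"
    by (simp add: F_def S_def d_a sum_subtractf diff_divide_distrib)
  finally have r: "(\<integral>\<^sup>+x. ?r x \<partial>lborel) = ennreal (S / d)" .
  have r': "(\<integral>\<^sup>+x. ?r (- x) \<partial>lborel) = (\<integral>\<^sup>+x. ?r x \<partial>lborel)"
    by (rule nn_integral_reflect) measurable
  have "2 * S / d = S / d + S / d" by simp
  \<comment> \<open>\<open>ennreal\<close> sends negative numbers to 0, so the inequality holds
    whatever the sign of \<open>S\<close>.\<close>
  then have "ennreal (2 * S / d) \<le> ennreal (S / d) + ennreal (S / d)"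
    by (cases "S / d \<ge> 0") (simp_all add: ennreal_neg flip: ennreal_plus)
  also have "\<dots> = (\<integral>\<^sup>+x. ?r x + ?r (- x) \<partial>lborel)"
    using r r' by (subst nn_integral_add) auto
  also have "\<dots> \<le> (\<integral>\<^sup>+x. ennreal (profile d K x * neg_ln_profile d K x) \<partial>lborel)"
  proof (intro nn_integral_mono)
    fix x
    show "?r x + ?r (- x) \<le> ennreal (profile d K x * neg_ln_profile d K x)"
    proof (cases "1 / 2 - a \<le> \<bar>x\<bar> \<and> \<bar>x\<bar> \<le> 1 / 2 + a")
      case True
      let ?q = "logistic (d * (1 / 2 - \<bar>x\<bar>))"
      have "?r x + ?r (- x) = ennreal (k ?q)"
      proof (cases "x \<ge> 0")
        case x: True
        then have "x \<in> {1 / 2 - a..1 / 2 + a}" "- x \<notin> {1 / 2 - a..1 / 2 + a}" "\<bar>x\<bar> = x"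
          using True a_less_half unfolding atLeastAtMost_iff by linarith+
        then show ?thesis by (simp del: atLeastAtMost_iff)
      next
        case x: False
        then have "- x \<in> {1 / 2 - a..1 / 2 + a}" "x \<notin> {1 / 2 - a..1 / 2 + a}" "\<bar>x\<bar> = - x"
          using True a_less_half unfolding atLeastAtMost_iff by linarith+
        then show ?thesis by (simp del: atLeastAtMost_iff)
      qed
      also have "\<dots> \<le> ennreal (?q * - ln ?q)"
        by (intro ennreal_leI k_le) auto
      also have "?q * - ln ?q = profile d K x * neg_ln_profile d K x"
      proof -
        have "profile d K x = ?q" using True by (simp add: profile_eq)
        then show ?thesis unfolding neg_ln_profile_def by (simp add: less_imp_neq[symmetric])
      qed
      finally show ?thesis .
    next
      case False
      then have "- x \<notin> {1 / 2 - a..1 / 2 + a}" "x \<notin> {1 / 2 - a..1 / 2 + a}"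
        using a_less_half unfolding atLeastAtMost_iff by linarith+
      then show ?thesis by (simp del: atLeastAtMost_iff)
    qed
  qed
  finally show ?thesis by (simp add: S_def)
qed

end

section \<open>Random graphs\<close>

lemma finite_all_edges: "finite V \<Longrightarrow> finite (all_edges V)"
  by (rule finite_subset[of _ "Pow V"]) (auto simp: all_edges_def)

lemma card_all_edges: "finite V \<Longrightarrow> card (all_edges V) = card V choose 2"
  unfolding all_edges_def by (rule n_subsets)

lemma set_erdos_renyi: "set_pmf (erdos_renyi n p) \<subseteq> Pow (all_edges {1..n})"
  by (auto simp: erdos_renyi_def)

lemma finite_set_erdos_renyi: "finite (set_pmf (erdos_renyi n p))"
  by (rule finite_subset[OF set_erdos_renyi]) (simp add: finite_all_edges)

lemma integrable_erdos_renyi [simp]: "integrable (measure_pmf (erdos_renyi n p)) (f :: _ \<Rightarrow> real)"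
  by (rule integrable_measure_pmf_finite[OF finite_set_erdos_renyi])

lemma erdos_renyi_prob_avoids:
  assumes A: "A \<subseteq> all_edges {1..n}" and p: "0 \<le> p" "p \<le> 1"
  shows "measure_pmf.prob (erdos_renyi n p) {E. E \<inter> A = {}} = (1 - p) ^ card A"
proof -
  let ?U = "all_edges {1..n}"
  have fin: "finite ?U" by (simp add: finite_all_edges)
  define B where "B = (\<lambda>e. if e \<in> A then {False} else (UNIV :: bool set))"
  have "(\<lambda>f. {e \<in> ?U. f e}) -` {E. E \<inter> A = {}} = Pi ?U B"
    using A by (auto simp: B_def Pi_iff split: if_splits)
  then have "measure_pmf.prob (erdos_renyi n p) {E. E \<inter> A = {}} =
      measure_pmf.prob (Pi_pmf ?U False (\<lambda>_. bernoulli_pmf p)) (Pi ?U B)"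
    by (simp add: erdos_renyi_def)
  also have "\<dots> = (\<Prod>e\<in>?U. measure_pmf.prob (bernoulli_pmf p) (B e))"
    by (rule measure_Pi_pmf_Pi[OF fin])
  also have "\<dots> = (\<Prod>e\<in>A. 1 - p)"
    using A p by (intro prod.mono_neutral_cong_right fin) (auto simp: B_def measure_pmf_single)
  finally show ?thesis by simp
qed

text \<open>Vertex exposure: each possible edge is put into the block of its larger endpoint. Block
  \<open>i\<close> contains only edges at \<open>i\<close>, so there are \<open>n\<close> blocks and
  changing one of them is a change at a single vertex.\<close>

lemma erdos_renyi_exp_moment:
  fixes f :: "nat set set \<Rightarrow> real"
  assumes c: "0 \<le> c" "c \<le> 1"
    and f: "\<And>i E F. i \<in> {1..n} \<Longrightarrow> E \<subseteq> all_edges {1..n} \<Longrightarrow> F \<subseteq> all_edges {1..n} \<Longrightarrow>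
      {e \<in> E. i \<notin> e} = {e \<in> F. i \<notin> e} \<Longrightarrow> \<bar>f E - f F\<bar> \<le> c"
  shows "measure_pmf.expectation (erdos_renyi n p) (\<lambda>E. exp (f E)) \<le>
    exp (measure_pmf.expectation (erdos_renyi n p) f + real n * c\<^sup>2)"
proof -
  let ?U = "all_edges {1..n}"
  define B where "B i = {e \<in> ?U. Max e = i}" for i
  define g where "g = (\<lambda>h. f {e \<in> ?U. h e})"
  have edge: "Max e \<in> e" "Max e \<in> {1..n}" if "e \<in> ?U" for e
  proof -
    have "finite e" "e \<noteq> {}" using that by (auto simp: all_edges_def intro: finite_subset)
    then show "Max e \<in> e" by simp
    then show "Max e \<in> {1..n}" using that by (auto simp: all_edges_def)
  qed
  have U: "(\<Union>i\<in>{1..n}. B i) = ?U" using edge by (auto simp: B_def)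
  have "measure_pmf.expectation (Pi_pmf (\<Union>i\<in>{1..n}. B i) False (\<lambda>_. bernoulli_pmf p)) (\<lambda>h. exp (g h)) \<le>
      exp (measure_pmf.expectation (Pi_pmf (\<Union>i\<in>{1..n}. B i) False (\<lambda>_. bernoulli_pmf p)) g
        + real (card {1..n}) * c\<^sup>2)"
  proof (rule bounded_differences_exp_moment)
    show "finite (B i)" for i by (simp add: B_def finite_all_edges)
    show "disjoint_family_on B {1..n}" by (auto simp: disjoint_family_on_def B_def)
    show "\<bar>g h - g h'\<bar> \<le> c" if "i \<in> {1..n}" "\<And>e. e \<notin> B i \<Longrightarrow> h e = h' e" for i h h'
      unfolding g_def
    proof (rule f[OF that(1)])
      have "h e = h' e" if "e \<in> ?U" "i \<notin> e" for e
        using that edge(1)[of e] \<open>\<And>e. e \<notin> B i \<Longrightarrow> h e = h' e\<close>[of e] by (auto simp: B_def)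
      then show "{e \<in> {e \<in> ?U. h e}. i \<notin> e} = {e \<in> {e \<in> ?U. h' e}. i \<notin> e}" by auto
    qed auto
  qed (use c in auto)
  then show ?thesis unfolding U by (simp add: erdos_renyi_def g_def)
qed

text \<open>Union bound over vertex sets of size exactly \<open>s\<close>, of which there are at
  most \<open>2 ^ n\<close>; a larger independent set contains an independent set of that
  size.\<close>

lemma erdos_renyi_independent_set_prob:
  assumes p: "0 \<le> p" "p \<le> 1"
  shows "measure_pmf.prob (erdos_renyi n p)
      {E. \<exists>S. S \<subseteq> {1..n} \<and> s \<le> card S \<and> (\<forall>e\<in>E. \<not> e \<subseteq> S)} \<le> 2 ^ n * (1 - p) ^ (s choose 2)"
proof -
  define \<S> where "\<S> = {S. S \<subseteq> {1..n} \<and> card S = s}"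
  have fin: "finite \<S>" by (rule finite_subset[of _ "Pow {1..n}"]) (auto simp: \<S>_def)
  have sub: "{E. \<exists>S. S \<subseteq> {1..n} \<and> s \<le> card S \<and> (\<forall>e\<in>E. \<not> e \<subseteq> S)} \<subseteq> (\<Union>S\<in>\<S>. {E. E \<inter> all_edges S = {}})"
  proof
    fix E assume "E \<in> {E. \<exists>S. S \<subseteq> {1..n} \<and> s \<le> card S \<and> (\<forall>e\<in>E. \<not> e \<subseteq> S)}"
    then obtain S where S: "S \<subseteq> {1..n}" "s \<le> card S" "\<forall>e\<in>E. \<not> e \<subseteq> S" by blast
    obtain T where T: "T \<subseteq> S" "card T = s" using obtain_subset_with_card_n[OF S(2)] by metis
    then have "T \<in> \<S>" "E \<inter> all_edges T = {}"
      using S unfolding \<S>_def all_edges_def by blast+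
    then show "E \<in> (\<Union>S\<in>\<S>. {E. E \<inter> all_edges S = {}})" by blast
  qed
  have "measure_pmf.prob (erdos_renyi n p) {E. E \<inter> all_edges S = {}} = (1 - p) ^ (s choose 2)" if "S \<in> \<S>" for S
  proof -
    have "all_edges S \<subseteq> all_edges {1..n}" "finite S" "card S = s"
      using that by (auto simp: \<S>_def all_edges_def intro: finite_subset)
    then show ?thesis using p by (simp add: erdos_renyi_prob_avoids card_all_edges)
  qed
  then have "(\<Sum>S\<in>\<S>. measure_pmf.prob (erdos_renyi n p) {E. E \<inter> all_edges S = {}}) =
      real (card \<S>) * (1 - p) ^ (s choose 2)" by simp
  moreover have "card \<S> \<le> card (Pow {1..n})" by (intro card_mono) (auto simp: \<S>_def)
  then have "real (card \<S>) \<le> 2 ^ n" by (simp add: card_Pow)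
  then have "real (card \<S>) * (1 - p) ^ (s choose 2) \<le> 2 ^ n * (1 - p) ^ (s choose 2)"
    using p by (intro mult_right_mono) auto
  moreover have "measure_pmf.prob (erdos_renyi n p) {E. \<exists>S. S \<subseteq> {1..n} \<and> s \<le> card S \<and> (\<forall>e\<in>E. \<not> e \<subseteq> S)}
      \<le> measure_pmf.prob (erdos_renyi n p) (\<Union>S\<in>\<S>. {E. E \<inter> all_edges S = {}})"
    using sub by (intro measure_pmf.finite_measure_mono) auto
  moreover have "\<dots> \<le> (\<Sum>S\<in>\<S>. measure_pmf.prob (erdos_renyi n p) {E. E \<inter> all_edges S = {}})"
    using fin by (intro measure_pmf.finite_measure_subadditive_finite) auto
  ultimately show ?thesis by linarith
qed

section \<open>From the box volume to the growth constant\<close>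

lemma root_set_independent:
  assumes G: "finite_graph V E" and R: "is_root_set V E R" and e: "e \<in> E"
  shows "\<not> e \<subseteq> R"
proof
  assume sub: "e \<subseteq> R"
  have E: "E \<subseteq> all_edges V" using G by (simp add: finite_graph_def)
  then have "card e = 2" using e by (auto simp: all_edges_def)
  then obtain u v where uv: "e = {u, v}" "u \<noteq> v" by (auto simp: card_2_iff)
  have "u \<in> V" "(u, v) \<in> reachable V E"
    using edge_mem_vertices[OF E] edge_reachable[OF E] e uv by auto
  moreover have "(u, u) \<in> reachable V E" using \<open>u \<in> V\<close> by (simp add: reachable_def)
  ultimately show False using root_exists1[OF R, of u] sub uv by blast
qed

lemma card_components_le:
  assumes "finite V" and R: "is_root_set V E R"
  shows "card (graph_components V E) \<le> card R"
proof -
  have "graph_components V E \<subseteq> (\<lambda>r. reachable V E `` {r}) ` R"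
  proof
    fix C assume C: "C \<in> graph_components V E"
    then obtain r where r: "r \<in> R" "r \<in> C" using R by (auto simp: is_root_set_def)
    obtain v where "C = reachable V E `` {v}" using C by (auto simp: graph_components_def elim: quotientE)
    then have "C = reachable V E `` {r}"
      using r(2) equiv_class_eq[OF equiv_reachable, of v r V E] by auto
    then show "C \<in> (\<lambda>r. reachable V E `` {r}) ` R" using r by blast
  qed
  moreover have "finite R" using assms by (auto simp: is_root_set_def intro: finite_subset)
  ultimately show ?thesis by (meson card_image_le card_mono finite_imageI le_trans)
qed

text \<open>The roots form an independent set, so there are fewer than \<open>s\<close> of them, and
  each costs at most \<open>ln (1 + 2 * a) \<le> 2 * a\<close>. The exponent \<open>m\<close> may be
  smaller than \<open>card V\<close>, which only helps because \<open>t \<ge> 0\<close>.\<close>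

lemma ln_growth_constant_ge:
  assumes G: "finite_graph V E" and a: "a \<ge> 0" and t: "t \<ge> 0"
    and indep: "\<And>S. S \<subseteq> V \<Longrightarrow> (\<forall>e\<in>E. \<not> e \<subseteq> S) \<Longrightarrow> card S < s" and s: "s \<le> card V"
    and Z: "ln (box_volume a V E) \<ge> real (card V) * t + real s * (2 * a)"
  shows "ln (growth_constant V E) \<ge> t"
proof -
  define m where "m = card V - card (graph_components V E)"
  obtain R where R: "is_root_set V E R" and gm: "m > 0 \<Longrightarrow> growth_constant V E ^ m = polytope_volume V E R"
    and gpos: "growth_constant V E > 0"
    using growth_constant[OF G] unfolding m_def by blast
  have finV: "finite V" and E: "E \<subseteq> all_edges V" using G by (auto simp: finite_graph_def)
  have "R \<subseteq> V" using R by (simp add: is_root_set_def)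
  then have Rs: "card R < s" using indep root_set_independent[OF G R] by blast
  \<comment> \<open>There are at most \<open>card R < s \<le> card V\<close> components;
    \<open>m > 0\<close> excludes the default value of \<open>growth_constant\<close>.\<close>
  then have m: "m > 0" "m \<le> card V" using card_components_le[OF finV R] s by (auto simp: m_def)
  have vol: "polytope_volume V E R > 0" by (rule polytope_volume_pos[OF G R])
  have "ln (box_volume a V E) \<le> ln ((1 + 2 * a) ^ card R * polytope_volume V E R)"
    using box_volume_le_polytope_volume[OF G R a] box_volume_ge_one[OF finV E a] by (intro ln_mono) auto
  also have "\<dots> = real (card R) * ln (1 + 2 * a) + ln (polytope_volume V E R)"
    using a vol by (simp add: ln_mult ln_realpow)
  also have "real (card R) * ln (1 + 2 * a) \<le> real s * (2 * a)"
    using Rs a ln_add_one_self_le_self[of "2 * a"] by (intro mult_mono) auto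
  finally have "real (card V) * t \<le> ln (polytope_volume V E R)" using Z by linarith
  also have "\<dots> = real m * ln (growth_constant V E)"
    using gm[OF m(1)] gpos by (metis ln_realpow)
  finally have "real (card V) * t \<le> real m * ln (growth_constant V E)" .
  moreover have "real m * t \<le> real (card V) * t" using m t by (intro mult_right_mono) auto
  ultimately have "real m * t \<le> real m * ln (growth_constant V E)" by linarith
  then show ?thesis using m by simp
qed

section \<open>The expected volume\<close>

lemma PiM_density:
  fixes f :: "real \<Rightarrow> real"
  assumes I: "finite I" and f [measurable]: "f \<in> borel_measurable borel"
    and mass: "(\<integral>\<^sup>+x. ennreal (f x) \<partial>lborel) = 1"
  shows "(\<Pi>\<^sub>M v \<in> I. density lborel (\<lambda>x. ennreal (f x))) =
    density (\<Pi>\<^sub>M v \<in> I. lborel) (\<lambda>x. \<Prod>v\<in>I. ennreal (f (x v)))"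
proof -
  let ?\<mu> = "density lborel (\<lambda>x. ennreal (f x))"
  have "prob_space ?\<mu>" using mass by (intro prob_spaceI) (simp add: emeasure_density)
  then interpret \<mu>: product_prob_space "\<lambda>_ :: 'a. ?\<mu>"
    by (intro product_prob_spaceI)
  have sets_eq: "sets (\<Pi>\<^sub>M v \<in> I. ?\<mu>) = sets (\<Pi>\<^sub>M v \<in> I. (lborel :: real measure))"
    by (intro sets_PiM_cong) auto
  have meas: "(\<lambda>x. \<Prod>v\<in>I. ennreal (f (x v))) \<in> borel_measurable (\<Pi>\<^sub>M v \<in> I. lborel)"
    by measurable
  have "density (\<Pi>\<^sub>M v \<in> I. lborel) (\<lambda>x. \<Prod>v\<in>I. ennreal (f (x v))) = (\<Pi>\<^sub>M v \<in> I. ?\<mu>)"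
  proof (rule \<mu>.PiM_eqI[OF I])
    show "sets (density (\<Pi>\<^sub>M v \<in> I. lborel) (\<lambda>x. \<Prod>v\<in>I. ennreal (f (x v)))) = sets (\<Pi>\<^sub>M v \<in> I. ?\<mu>)"
      by (simp add: sets_eq)
    fix A :: "'a \<Rightarrow> real set" assume A: "\<And>v. v \<in> I \<Longrightarrow> A v \<in> sets ?\<mu>"
    then have A': "\<And>v. v \<in> I \<Longrightarrow> A v \<in> sets lborel" by simp
    have "emeasure (density (\<Pi>\<^sub>M v \<in> I. lborel) (\<lambda>x. \<Prod>v\<in>I. ennreal (f (x v)))) (Pi\<^sub>E I A) =
        (\<integral>\<^sup>+x. (\<Prod>v\<in>I. ennreal (f (x v))) * indicator (Pi\<^sub>E I A) x \<partial>(\<Pi>\<^sub>M v \<in> I. lborel))"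
      using A' I meas by (intro emeasure_density sets_PiM_I_finite) auto
    also have "\<dots> = (\<integral>\<^sup>+x. (\<Prod>v\<in>I. ennreal (f (x v)) * indicator (A v) (x v)) \<partial>(\<Pi>\<^sub>M v \<in> I. lborel))"
    proof (intro nn_integral_cong)
      fix x :: "'a \<Rightarrow> real" assume "x \<in> space (\<Pi>\<^sub>M v \<in> I. lborel)"
      then have "indicator (Pi\<^sub>E I A) x = (\<Prod>v\<in>I. indicator (A v) (x v) :: ennreal)"
        using I by (auto simp: space_PiM PiE_iff indicator_def prod_zero_iff)
      then show "(\<Prod>v\<in>I. ennreal (f (x v))) * indicator (Pi\<^sub>E I A) x =
          (\<Prod>v\<in>I. ennreal (f (x v)) * indicator (A v) (x v))" by (simp add: prod.distrib)
    qed
    also have "\<dots> = (\<Prod>v\<in>I. \<integral>\<^sup>+x. ennreal (f x) * indicator (A v) x \<partial>lborel)"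
      using A' I by (intro lborel_product.product_nn_integral_prod) auto
    also have "\<dots> = (\<Prod>v\<in>I. emeasure ?\<mu> (A v))"
      using A' by (intro prod.cong refl) (simp add: emeasure_density)
    finally show "emeasure (density (\<Pi>\<^sub>M v \<in> I. lborel) (\<lambda>x. \<Prod>v\<in>I. ennreal (f (x v)))) (Pi\<^sub>E I A) =
        (\<Prod>v\<in>I. emeasure ?\<mu> (A v))" .
  qed
  then show ?thesis ..
qed

section \<open>The product measure with the profile as density\<close>

context truncated_profile
begin

definition profile_measure :: "real measure" where
  "profile_measure = density lborel (\<lambda>x. ennreal (profile d K x))"

text \<open>The differential entropy of the profile. The convention for
  \<open>neg_ln_profile\<close> off the support concerns only a null set of
  \<open>profile_measure\<close>.\<close>

definition profile_entropy :: real where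
  "profile_entropy = (\<integral>x. neg_ln_profile d K x \<partial>profile_measure)"

lemma sets_profile_measure [measurable_cong, simp]: "sets profile_measure = sets borel"
  and space_profile_measure [simp]: "space profile_measure = UNIV"
  by (simp_all add: profile_measure_def)

sublocale profile: prob_space profile_measure
  by (rule prob_spaceI) (simp add: profile_measure_def emeasure_density profile_mass)

sublocale profile_product: product_prob_space "\<lambda>_ :: nat. profile_measure"
  by (intro product_prob_spaceI) (rule profile.prob_space_axioms)

lemma nn_integral_neg_ln_profile:
  "(\<integral>\<^sup>+x. ennreal (neg_ln_profile d K x) \<partial>profile_measure) = ennreal profile_entropy"
  unfolding profile_entropy_def
proof (intro nn_integral_eq_integral)
  show "integrable profile_measure (neg_ln_profile d K)"
    using neg_ln_profile_bounded
    by (intro profile.integrable_const_bound[of _ "max d (ln (1 + exp K))"]) auto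
qed auto

lemma profile_entropy_nonneg: "profile_entropy \<ge> 0"
  by (simp add: profile_entropy_def)

lemma profile_entropy_lower_bound:
  "profile_entropy \<ge> 2 * (\<Sum>n<N. dilog_term n (logistic K) - dilog_term n (logistic (- K))) / d"
proof -
  have "ennreal profile_entropy = (\<integral>\<^sup>+x. ennreal (profile d K x * neg_ln_profile d K x) \<partial>lborel)"
    unfolding nn_integral_neg_ln_profile[symmetric] profile_measure_def
    by (subst nn_integral_density) (auto simp: ennreal_mult)
  then have "ennreal (2 * (\<Sum>n<N. dilog_term n (logistic K) - dilog_term n (logistic (- K))) / d)
      \<le> ennreal profile_entropy" using profile_entropy_ge[of N] by simp
  then show ?thesis by (simp only: ennreal_le_iff[OF profile_entropy_nonneg])
qed

lemma profile_product_component: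
  assumes "finite I" "i \<in> I" and [measurable]: "g \<in> borel_measurable borel"
  shows "(\<integral>\<^sup>+x. g (x i) \<partial>(\<Pi>\<^sub>M v \<in> I. profile_measure)) = (\<integral>\<^sup>+y. g y \<partial>profile_measure)"
proof -
  have "(\<integral>\<^sup>+y. g y \<partial>profile_measure) = (\<integral>\<^sup>+y. g y \<partial>distr (\<Pi>\<^sub>M v \<in> I. profile_measure) profile_measure (\<lambda>x. x i))"
    using assms(2) by (subst distr_PiM_component) (auto intro: profile.prob_space_axioms)
  also have "\<dots> = (\<integral>\<^sup>+x. g (x i) \<partial>(\<Pi>\<^sub>M v \<in> I. profile_measure))"
    using assms(2) by (intro nn_integral_distr) measurable
  finally show ?thesis ..
qed

text \<open>Integrating out the coordinate of \<open>u\<close> first turns the conflict probability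
  into the mass in conflict with \<open>x w\<close>. Self-consistency bounds this mass by
  \<open>neg_ln_profile d K (x w) / d\<close>, whose mean is the right-hand side; so one number
  controls both energy and entropy.\<close>

lemma profile_conflict_expectation_le:
  fixes I :: "nat set"
  assumes I: "finite I" "u \<in> I" "w \<in> I" "u \<noteq> w"
  shows "(\<integral>x. indicator {x. \<bar>x u - x w\<bar> > 1} x \<partial>(\<Pi>\<^sub>M v \<in> I. profile_measure)) \<le> profile_entropy / d"
proof -
  let ?M = "\<Pi>\<^sub>M v \<in> I. profile_measure" and ?J = "I - {u}"
  have J: "finite ?J" "u \<notin> ?J" "insert u ?J = I" "w \<in> ?J" using I by auto
  have meas: "(\<lambda>x. indicator {x. \<bar>x u - x w\<bar> > 1} x :: ennreal) \<in> borel_measurable ?M"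
  proof -
    have "{x \<in> space ?M. \<bar>x u - x w\<bar> > 1} \<in> sets ?M" using I by measurable
    then show ?thesis by (intro borel_measurable_indicator') (auto simp: Int_def)
  qed
  have "(\<integral>\<^sup>+x. indicator {x. \<bar>x u - x w\<bar> > 1} x \<partial>?M) =
      (\<integral>\<^sup>+x. \<integral>\<^sup>+y. indicator {x. \<bar>x u - x w\<bar> > 1} (x(u := y)) \<partial>profile_measure \<partial>(\<Pi>\<^sub>M v \<in> ?J. profile_measure))"
    using profile_product.product_nn_integral_insert[OF J(1,2), of "indicator {x. \<bar>x u - x w\<bar> > 1}"] meas
    unfolding J(3) by simp
  also have "\<dots> \<le> (\<integral>\<^sup>+x. ennreal (neg_ln_profile d K (x w) / d) \<partial>(\<Pi>\<^sub>M v \<in> ?J. profile_measure))"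
  proof (intro nn_integral_mono)
    fix x :: "nat \<Rightarrow> real"
    have "(\<integral>\<^sup>+y. indicator {x. \<bar>x u - x w\<bar> > 1} (x(u := y)) \<partial>profile_measure) =
        (\<integral>\<^sup>+y. indicator {y. \<bar>y - x w\<bar> > 1} y \<partial>profile_measure)"
      using I(4) by (intro nn_integral_cong) (simp add: indicator_def)
    also have "\<dots> = (\<integral>\<^sup>+y. ennreal (profile d K y) * indicator {y. \<bar>y - x w\<bar> > 1} y \<partial>lborel)"
      unfolding profile_measure_def by (subst nn_integral_density) auto
    also have "\<dots> \<le> ennreal (neg_ln_profile d K (x w) / d)" by (rule profile_conflict_mass_le)
    finally show "(\<integral>\<^sup>+y. indicator {x. \<bar>x u - x w\<bar> > 1} (x(u := y)) \<partial>profile_measure)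
        \<le> ennreal (neg_ln_profile d K (x w) / d)" .
  qed
  also have "\<dots> = (\<integral>\<^sup>+y. ennreal (neg_ln_profile d K y / d) \<partial>profile_measure)"
    using J by (intro profile_product_component) auto
  also have "\<dots> = (\<integral>\<^sup>+y. ennreal (neg_ln_profile d K y) * ennreal (1 / d) \<partial>profile_measure)"
    using d_pos by (intro nn_integral_cong) (simp flip: ennreal_mult'')
  also have "\<dots> = ennreal profile_entropy * ennreal (1 / d)"
    by (subst nn_integral_multc) (auto simp: nn_integral_neg_ln_profile)
  also have "\<dots> = ennreal (profile_entropy / d)"
    using d_pos profile_entropy_nonneg by (simp flip: ennreal_mult'')
  finally have "(\<integral>\<^sup>+x. ennreal (indicator {x. \<bar>x u - x w\<bar> > 1} x) \<partial>?M) \<le> ennreal (profile_entropy / d)"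
    by (simp add: ennreal_indicator)
  then show ?thesis
    using d_pos profile_entropy_nonneg by (intro integral_real_bounded) auto
qed

end

section \<open>Averaging over the random graph\<close>

lemma edge_Min_Max:
  fixes e :: "nat set"
  assumes "e \<in> all_edges V"
  shows "e = {Min e, Max e}" "Min e \<noteq> Max e" "Min e \<in> V" "Max e \<in> V"
proof -
  obtain u v where "e = {u, v}" "u \<noteq> v" "u \<in> V" "v \<in> V"
    using assms by (auto simp: all_edges_def card_2_iff)
  then show "e = {Min e, Max e}" "Min e \<noteq> Max e" "Min e \<in> V" "Max e \<in> V"
    by (auto simp: min_def max_def)
qed

text \<open>\<open>Min\<close> and \<open>Max\<close> merely order the two ends of a pair, so that
  \<open>x\<close> can be evaluated at each.\<close>

definition conflicts :: "nat set \<Rightarrow> (nat \<Rightarrow> real) \<Rightarrow> nat set set" where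
  "conflicts V x = {e \<in> all_edges V. \<bar>x (Min e) - x (Max e)\<bar> > 1}"

text \<open>For fixed \<open>x\<close>, membership becomes the event that the random edge set avoids
  a deterministic set of pairs, as in \<open>erdos_renyi_prob_avoids\<close>.\<close>

lemma boxed_polytope_conflicts:
  fixes V :: "nat set"
  assumes E: "E \<subseteq> all_edges V"
  shows "x \<in> boxed_polytope a V E \<longleftrightarrow> x \<in> V \<rightarrow>\<^sub>E {- (1 / 2 + a)..1 / 2 + a} \<and> E \<inter> conflicts V x = {}"
proof -
  have "(\<forall>u v. {u, v} \<in> E \<longrightarrow> \<bar>x u - x v\<bar> \<le> 1) \<longleftrightarrow> E \<inter> conflicts V x = {}"
  proof safe
    fix e assume *: "\<forall>u v. {u, v} \<in> E \<longrightarrow> \<bar>x u - x v\<bar> \<le> 1" "e \<in> E" "e \<in> conflicts V x"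
    then have "{Min e, Max e} \<in> E" using edge_Min_Max(1)[of e V] by (auto simp: conflicts_def)
    then have "\<bar>x (Min e) - x (Max e)\<bar> \<le> 1" using *(1) by blast
    then show "e \<in> {}" using *(3) by (simp add: conflicts_def)
  next
    fix u v assume *: "E \<inter> conflicts V x = {}" "{u, v} \<in> E"
    then have "\<not> \<bar>x (Min {u, v}) - x (Max {u, v})\<bar> > 1" using E by (auto simp: conflicts_def)
    then show "\<bar>x u - x v\<bar> \<le> 1" by (cases "u \<le> v") (auto simp: min_def max_def abs_minus_commute)
  qed
  then show ?thesis by (simp add: boxed_polytope_def)
qed

text \<open>The expectation is a finite sum and can be moved inside the volume integral. The result
  is the partition function of the mean-field gas.\<close>

lemma expected_box_volume:
  assumes a: "a \<ge> 0" and p: "0 \<le> p" "p \<le> 1"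
  shows "ennreal (measure_pmf.expectation (erdos_renyi n p) (box_volume a {1..n})) =
    (\<integral>\<^sup>+x. ennreal ((1 - p) ^ card (conflicts {1..n} x)) *
      indicator ({1..n} \<rightarrow>\<^sub>E {- (1 / 2 + a)..1 / 2 + a}) x \<partial>(\<Pi>\<^sub>M v \<in> {1..n}. lborel))"
proof -
  let ?V = "{1..n}" and ?P = "erdos_renyi n p"
  let ?B = "?V \<rightarrow>\<^sub>E {- (1 / 2 + a)..1 / 2 + a}"
  let ?L = "\<Pi>\<^sub>M v \<in> ?V. (lborel :: real measure)"
  have fin: "finite (set_pmf ?P)" by (rule finite_set_erdos_renyi)
  have sub: "E \<subseteq> all_edges ?V" if "E \<in> set_pmf ?P" for E using that set_erdos_renyi by blast
  have "measure_pmf.expectation ?P (box_volume a ?V) = (\<Sum>E\<in>set_pmf ?P. box_volume a ?V E * pmf ?P E)"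
    using fin by (intro integral_measure_pmf_real) auto
  then have "ennreal (measure_pmf.expectation ?P (box_volume a ?V)) =
      (\<Sum>E\<in>set_pmf ?P. emeasure ?L (boxed_polytope a ?V E) * ennreal (pmf ?P E))"
    using a by (simp add: emeasure_boxed_polytope box_volume_def ennreal_mult sum_ennreal[symmetric])
  also have "\<dots> = (\<Sum>E\<in>set_pmf ?P. \<integral>\<^sup>+x. ennreal (pmf ?P E) * indicator (boxed_polytope a ?V E) x \<partial>?L)"
    using sub by (intro sum.cong refl)
      (subst nn_integral_cmult_indicator, auto intro!: boxed_polytope_measurable simp: mult.commute)
  also have "\<dots> = (\<integral>\<^sup>+x. (\<Sum>E\<in>set_pmf ?P. ennreal (pmf ?P E) * indicator (boxed_polytope a ?V E) x) \<partial>?L)"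
    using sub by (intro nn_integral_sum[symmetric] borel_measurable_times_ennreal borel_measurable_indicator)
      (auto intro!: boxed_polytope_measurable)
  also have "\<dots> = (\<integral>\<^sup>+x. ennreal ((1 - p) ^ card (conflicts ?V x)) * indicator ?B x \<partial>?L)"
  proof (intro nn_integral_cong)
    fix x
    have "(\<Sum>E\<in>set_pmf ?P. ennreal (pmf ?P E) * indicator (boxed_polytope a ?V E) x) =
        (\<Sum>E\<in>set_pmf ?P. ennreal (pmf ?P E * indicator {E. E \<inter> conflicts ?V x = {}} E) * indicator ?B x)"
      using sub by (intro sum.cong refl) (simp add: boxed_polytope_conflicts indicator_def)
    also have "\<dots> = ennreal (\<Sum>E\<in>set_pmf ?P. pmf ?P E * indicator {E. E \<inter> conflicts ?V x = {}} E) * indicator ?B x"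
      by (simp add: sum_distrib_right[symmetric] sum_ennreal)
    also have "(\<Sum>E\<in>set_pmf ?P. pmf ?P E * indicator {E. E \<inter> conflicts ?V x = {}} E) =
        measure_pmf.expectation ?P (indicator {E. E \<inter> conflicts ?V x = {}})"
      using fin by (subst integral_measure_pmf_real[where A = "set_pmf ?P"]) (auto simp: mult.commute)
    also have "\<dots> = measure_pmf.prob ?P {E. E \<inter> conflicts ?V x = {}}" by simp
    also have "\<dots> = (1 - p) ^ card (conflicts ?V x)"
      using p by (intro erdos_renyi_prob_avoids) (auto simp: conflicts_def)
    finally show "(\<Sum>E\<in>set_pmf ?P. ennreal (pmf ?P E) * indicator (boxed_polytope a ?V E) x) =
        ennreal ((1 - p) ^ card (conflicts ?V x)) * indicator ?B x" .
  qed
  finally show ?thesis .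
qed

text \<open>Jensen's inequality for the product measure with density \<open>profile d K\<close>.\<close>

lemma (in truncated_profile) expected_box_volume_ge:
  assumes p: "0 \<le> p" "p < 1"
  shows "exp (real n * profile_entropy + real (n choose 2) * ln (1 - p) * (profile_entropy / d)) \<le>
    measure_pmf.expectation (erdos_renyi n p) (box_volume a {1..n})"
proof -
  let ?V = "{1..n}" and ?H = "profile_entropy"
  let ?B = "?V \<rightarrow>\<^sub>E {- (1 / 2 + a)..1 / 2 + a}"
  let ?L = "\<Pi>\<^sub>M v \<in> ?V. (lborel :: real measure)"
  let ?M = "\<Pi>\<^sub>M v \<in> ?V. profile_measure"
  define h where "h = neg_ln_profile d K"
  define c where "c = (\<lambda>(e :: nat set) (x :: nat \<Rightarrow> real). indicator {x. \<bar>x (Min e) - x (Max e)\<bar> > 1} x :: real)"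
  \<comment> \<open>On the window \<open>exp (g x)\<close> is the Gibbs weight divided by the
    product density, so its integral under \<open>?M\<close> is the expected volume; the mean of
    \<open>g\<close> is the variational functional.\<close>
  define g where "g = (\<lambda>x. (\<Sum>e\<in>all_edges ?V. ln (1 - p) * c e x) + (\<Sum>v\<in>?V. h (x v)))"
  interpret M: prob_space ?M
    by (rule prob_space_PiM) (rule profile.prob_space_axioms)
  have fin: "finite (all_edges ?V)" by (simp add: finite_all_edges)
  have h_meas [measurable]: "h \<in> borel_measurable borel" unfolding h_def by measurable
  define C where "C = max d (ln (1 + exp K))"
  have h: "0 \<le> h y" "h y \<le> C" for y
    using neg_ln_profile_bounded neg_ln_profile_nonneg by (auto simp: h_def C_def)
  have comp_meas: "(\<lambda>x. x v) \<in> borel_measurable ?M" if "v \<in> ?V" for v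
  proof -
    have "measurable ?M profile_measure = borel_measurable ?M" by (rule measurable_cong_sets) simp_all
    then show ?thesis using measurable_component_singleton[OF that, of "\<lambda>_. profile_measure"] by blast
  qed
  have hv_meas: "(\<lambda>x. h (x v)) \<in> borel_measurable ?M" if "v \<in> ?V" for v
    using comp_meas[OF that] by measurable
  have c_meas: "c e \<in> borel_measurable ?M" if "e \<in> all_edges ?V" for e
  proof -
    have [measurable]: "(\<lambda>x. x (Min e)) \<in> borel_measurable ?M" "(\<lambda>x. x (Max e)) \<in> borel_measurable ?M"
      using edge_Min_Max(3,4)[OF that] by (auto intro!: comp_meas)
    have "{x \<in> space ?M. \<bar>x (Min e) - x (Max e)\<bar> > 1} \<in> sets ?M" by measurable
    then show ?thesis unfolding c_def by (intro borel_measurable_indicator') (auto simp: Int_def)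
  qed
  have int_h: "integrable ?M (\<lambda>x. h (x v))" if "v \<in> ?V" for v
    using hv_meas[OF that] h by (intro M.integrable_const_bound[of _ C]) auto
  have int_c: "integrable ?M (c e)" if "e \<in> all_edges ?V" for e
    using c_meas[OF that] by (intro M.integrable_const_bound[of _ 1]) (auto simp: c_def)
  have int_g: "integrable ?M g"
    unfolding g_def using int_h int_c by (intro Bochner_Integration.integrable_add Bochner_Integration.integrable_sum
      integrable_mult_right) auto
  have g_le: "g x \<le> real n * C" for x
  proof -
    have "(\<Sum>e\<in>all_edges ?V. ln (1 - p) * c e x) \<le> 0"
      using p by (intro sum_nonpos mult_nonpos_nonneg) (auto simp: c_def)
    moreover have "(\<Sum>v\<in>?V. h (x v)) \<le> (\<Sum>v\<in>?V. C)" using h by (intro sum_mono) auto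
    ultimately show ?thesis by (simp add: g_def)
  qed
  have int_exp: "integrable ?M (\<lambda>x. exp (g x))"
    using borel_measurable_integrable[OF int_g] g_le
    by (intro M.integrable_const_bound[of _ "exp (real n * C)"]) auto
  have Eh: "(\<integral>x. h (x v) \<partial>?M) = ?H" if "v \<in> ?V" for v
  proof -
    have "ennreal (\<integral>x. h (x v) \<partial>?M) = (\<integral>\<^sup>+x. ennreal (h (x v)) \<partial>?M)"
      using int_h[OF that] h by (intro nn_integral_eq_integral[symmetric]) auto
    also have "\<dots> = (\<integral>\<^sup>+y. ennreal (h y) \<partial>profile_measure)"
      using that by (intro profile_product_component[where g = "\<lambda>y. ennreal (h y)"]) auto
    also have "\<dots> = ennreal ?H" unfolding h_def by (rule nn_integral_neg_ln_profile)
    finally show ?thesis using profile_entropy_nonneg h by (simp add: integral_nonneg)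
  qed
  have Ec: "(\<integral>x. c e x \<partial>?M) \<le> ?H / d" if "e \<in> all_edges ?V" for e
    unfolding c_def using edge_Min_Max[OF that] by (intro profile_conflict_expectation_le) auto
  have "real n * ?H + real (n choose 2) * ln (1 - p) * (?H / d) =
      (\<Sum>e\<in>all_edges ?V. ln (1 - p) * (?H / d)) + (\<Sum>v\<in>?V. ?H)"
    by (simp add: card_all_edges)
  \<comment> \<open>\<open>ln (1 - p)\<close> is nonpositive, so the upper bound on the conflict
    probability becomes a lower bound on the energy term.\<close>
  also have "\<dots> \<le> (\<Sum>e\<in>all_edges ?V. ln (1 - p) * (\<integral>x. c e x \<partial>?M)) + (\<Sum>v\<in>?V. \<integral>x. h (x v) \<partial>?M)"
    using p Ec Eh by (intro add_mono sum_mono mult_left_mono_neg) auto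
  also have "\<dots> = (\<integral>x. g x \<partial>?M)"
    unfolding g_def using int_h int_c
    by (subst Bochner_Integration.integral_add; (subst Bochner_Integration.integral_sum)?; auto)+
  finally have "exp (real n * ?H + real (n choose 2) * ln (1 - p) * (?H / d)) \<le> exp (\<integral>x. g x \<partial>?M)" by simp
  also have "\<dots> \<le> (\<integral>x. exp (g x) \<partial>?M)"
    using int_g int_exp exp_convex by (intro M.jensens_inequality[where I = UNIV]) auto
  finally have "ennreal (exp (real n * ?H + real (n choose 2) * ln (1 - p) * (?H / d))) \<le>
      ennreal (\<integral>x. exp (g x) \<partial>?M)" by (rule ennreal_leI)
  also have "\<dots> = (\<integral>\<^sup>+x. ennreal (exp (g x)) \<partial>?M)"
    using int_exp by (intro nn_integral_eq_integral[symmetric]) auto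
  also have "?M = density ?L (\<lambda>x. \<Prod>v\<in>?V. ennreal (profile d K (x v)))"
    unfolding profile_measure_def by (rule PiM_density) (auto simp: profile_mass)
  also have "(\<integral>\<^sup>+x. ennreal (exp (g x)) \<partial>density ?L (\<lambda>x. \<Prod>v\<in>?V. ennreal (profile d K (x v)))) =
      (\<integral>\<^sup>+x. (\<Prod>v\<in>?V. ennreal (profile d K (x v))) * ennreal (exp (g x)) \<partial>?L)"
  proof (rule nn_integral_density)
    show "(\<lambda>x. \<Prod>v\<in>?V. ennreal (profile d K (x v))) \<in> borel_measurable ?L" by measurable
    have "sets ?M = sets ?L" by (intro sets_PiM_cong) auto
    then show "(\<lambda>x. ennreal (exp (g x))) \<in> borel_measurable ?L"
      using borel_measurable_integrable[OF int_exp] measurable_cong_sets[of ?M ?L borel borel] by simp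
  qed
  also have "\<dots> = (\<integral>\<^sup>+x. ennreal ((1 - p) ^ card (conflicts ?V x)) * indicator ?B x \<partial>?L)"
  proof (intro nn_integral_cong)
    fix x assume x: "x \<in> space ?L"
    have card: "(\<Sum>e\<in>all_edges ?V. c e x) = real (card (conflicts ?V x))"
    proof -
      have "(\<Sum>e\<in>all_edges ?V. c e x) = (\<Sum>e\<in>conflicts ?V x. 1)"
        unfolding c_def conflicts_def using fin by (intro sum.mono_neutral_cong_right) auto
      then show ?thesis by simp
    qed
    have "exp (\<Sum>e\<in>all_edges ?V. ln (1 - p) * c e x) = exp (real (card (conflicts ?V x)) * ln (1 - p))"
      unfolding sum_distrib_left[symmetric] card by (simp add: mult.commute)
    also have "\<dots> = (1 - p) ^ card (conflicts ?V x)"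
      using p by (simp add: exp_of_nat_mult)
    finally have exp_g: "exp (g x) = (1 - p) ^ card (conflicts ?V x) * (\<Prod>v\<in>?V. exp (h (x v)))"
      by (simp add: g_def exp_add exp_sum)
    \<comment> \<open>The density cancels \<open>exp (h (x v))\<close> on the window; outside it the
      density is 0, whatever value \<open>h\<close> has there.\<close>
    have "profile d K (x v) * exp (h (x v)) = indicator {- (1 / 2 + a)..1 / 2 + a} (x v)" for v
    proof (cases "\<bar>x v\<bar> > 1 / 2 + a")
      case True
      then have "profile d K (x v) = 0" by (simp only: profile_eq_0_iff)
      moreover have "x v \<notin> {- (1 / 2 + a)..1 / 2 + a}"
        using True unfolding atLeastAtMost_iff by linarith
      ultimately show ?thesis by (simp del: atLeastAtMost_iff)
    next
      case False
      then have "profile d K (x v) \<noteq> 0" by (simp only: profile_eq_0_iff not_False_eq_True)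
      then have "profile d K (x v) > 0" using profile_nonneg[of d K "x v"] by linarith
      moreover have "x v \<in> {- (1 / 2 + a)..1 / 2 + a}"
        using False unfolding atLeastAtMost_iff by linarith
      ultimately show ?thesis
        by (simp add: h_def neg_ln_profile_def exp_minus del: atLeastAtMost_iff)
    qed
    then have "(\<Prod>v\<in>?V. profile d K (x v)) * (\<Prod>v\<in>?V. exp (h (x v))) =
        (\<Prod>v\<in>?V. indicator {- (1 / 2 + a)..1 / 2 + a} (x v))"
      by (simp flip: prod.distrib)
    also have "\<dots> = indicator ?B x"
    proof (cases "x \<in> ?B")
      case True
      then show ?thesis by (simp add: PiE_iff)
    next
      case False
      then obtain v where "v \<in> ?V" "x v \<notin> {- (1 / 2 + a)..1 / 2 + a}"
        using x by (auto simp: space_PiM PiE_iff)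
      then have "(\<Prod>v\<in>?V. indicator {- (1 / 2 + a)..1 / 2 + a} (x v)) = (0 :: real)"
        by (intro prod_zero bexI[of _ v]) (simp_all del: atLeastAtMost_iff)
      then show ?thesis using False by (simp only: indicator_simps not_False_eq_True)
    qed
    finally have "(\<Prod>v\<in>?V. profile d K (x v)) * exp (g x) =
        (1 - p) ^ card (conflicts ?V x) * indicator ?B x"
      by (simp add: exp_g mult.left_commute)
    moreover have "(\<Prod>v\<in>?V. ennreal (profile d K (x v))) * ennreal (exp (g x)) =
        ennreal ((\<Prod>v\<in>?V. profile d K (x v)) * exp (g x))"
      by (simp add: prod_ennreal prod_nonneg ennreal_mult)
    ultimately show "(\<Prod>v\<in>?V. ennreal (profile d K (x v))) * ennreal (exp (g x)) =
        ennreal ((1 - p) ^ card (conflicts ?V x)) * indicator ?B x"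
      using p by (simp add: ennreal_mult ennreal_indicator)
  qed
  also have "\<dots> = ennreal (measure_pmf.expectation (erdos_renyi n p) (box_volume a ?V))"
    using p a_pos by (intro expected_box_volume[symmetric]) auto
  finally show ?thesis
    by (subst (asm) ennreal_le_iff) (auto intro!: integral_nonneg simp: box_volume_def)
qed

section \<open>The growth constant\<close>

text \<open>The exponential moment bound is used twice, with Lipschitz constant
  \<open>8 * a\<close>. Applied to \<open>ln Z\<close>, it shows that the mean of
  \<open>ln Z\<close> is at least \<open>ln (E Z) - 64 * a^2 * n\<close>; applied to
  \<open>- ln Z\<close>, together with Markov's inequality, it controls the lower tail around that
  mean.\<close>

lemma (in truncated_profile) ln_box_volume_lower_tail:
  assumes d8: "8 * K \<le> d" and n: "2 * d \<le> real n" "n > 0"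
    and J: "J \<ge> 0" "J \<le> (\<Sum>k<N. dilog_term k (logistic K) - dilog_term k (logistic (- K)))"
  defines "P \<equiv> erdos_renyi n (d / real n)"
  shows "measure_pmf.prob P {E. ln (box_volume a {1..n} E) \<le>
      real n * J / d - 2 * J - 64 * a\<^sup>2 * real n - s} \<le> exp (64 * a\<^sup>2 * real n - s)"
proof -
  let ?f = "\<lambda>E. ln (box_volume a {1..n} E)" and ?p = "d / real n"
  have a: "0 \<le> a" "a \<le> 1 / 4" "8 * a \<le> 1" using d8 K d_pos by (auto simp: a_def field_simps)
  have p: "0 \<le> ?p" "?p \<le> 1 / 2" using n d_pos by (auto simp: field_simps)
  have "\<bar>?f E - ?f F\<bar> \<le> 8 * a" if "i \<in> {1..n}" "E \<subseteq> all_edges {1..n}" "F \<subseteq> all_edges {1..n}"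
    "{e \<in> E. i \<notin> e} = {e \<in> F. i \<notin> e}" for i E F
    using that a by (intro ln_box_volume_vertex_change) auto
  note Lip = this
  define \<mu> where "\<mu> = measure_pmf.expectation P ?f"
  have up: "measure_pmf.expectation P (\<lambda>E. exp (?f E)) \<le> exp (\<mu> + real n * (8 * a)\<^sup>2)"
    unfolding \<mu>_def P_def using a Lip by (intro erdos_renyi_exp_moment) auto
  have "measure_pmf.expectation P (\<lambda>E. exp (- ?f E)) \<le> exp (measure_pmf.expectation P (\<lambda>E. - ?f E) + real n * (8 * a)\<^sup>2)"
    unfolding P_def
  proof (rule erdos_renyi_exp_moment)
    fix i E F assume "i \<in> {1..n}" "E \<subseteq> all_edges {1..n}" "F \<subseteq> all_edges {1..n}" "{e \<in> E. i \<notin> e} = {e \<in> F. i \<notin> e}"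
    from Lip[OF this] show "\<bar>- ?f E - - ?f F\<bar> \<le> 8 * a" by linarith
  qed (use a in auto)
  then have down: "measure_pmf.expectation P (\<lambda>E. exp (- ?f E)) \<le> exp (- \<mu> + real n * (8 * a)\<^sup>2)"
    by (simp add: \<mu>_def)
  have "measure_pmf.expectation P (\<lambda>E. exp (?f E)) = measure_pmf.expectation P (box_volume a {1..n})"
  proof (intro integral_cong_AE)
    show "AE E in measure_pmf P. exp (?f E) = box_volume a {1..n} E"
    proof (rule AE_pmfI)
      fix E assume "E \<in> set_pmf P"
      then have "E \<subseteq> all_edges {1..n}" using set_erdos_renyi by (auto simp: P_def)
      then have "box_volume a {1..n} E \<ge> 1" using a by (intro box_volume_ge_one) auto
      then show "exp (?f E) = box_volume a {1..n} E" by simp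
    qed
  qed auto
  with up have EZ: "measure_pmf.expectation P (box_volume a {1..n}) \<le> exp (\<mu> + 64 * a\<^sup>2 * real n)"
    by (simp add: power_mult_distrib mult_ac)
  have "exp (real n * profile_entropy + real (n choose 2) * ln (1 - ?p) * (profile_entropy / d)) \<le>
      measure_pmf.expectation P (box_volume a {1..n})"
    unfolding P_def using p by (intro expected_box_volume_ge) linarith+
  also note EZ
  finally have 1: "real n * profile_entropy + real (n choose 2) * ln (1 - ?p) * (profile_entropy / d) \<le> \<mu> + 64 * a\<^sup>2 * real n"
    by simp
  \<comment> \<open>By \<open>n choose 2 \<le> n^2 / 2\<close> and
    \<open>ln (1 - p) \<ge> - p - 2 * p^2\<close> with \<open>p = d / n\<close>, the repulsion
    consumes at most half of the entropy \<open>n * profile_entropy\<close>, up to an error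
    \<open>d * profile_entropy\<close>. This turns \<open>2 * J / d\<close> per vertex into
    \<open>J / d\<close> and accounts for the loss \<open>2 * J\<close>.\<close>
  have 2: "real n / 2 - d \<le> real n + real (n choose 2) * ln (1 - ?p) / d"
  proof -
    have ch: "real (n choose 2) \<le> (real n)\<^sup>2 / 2"
    proof -
      have "2 * (n choose 2) \<le> n * (n - 1)" by (simp add: choose_two)
      also have "\<dots> \<le> n * n" by (intro mult_le_mono2) simp
      finally have "2 * (n choose 2) \<le> n * n" .
      then have "real (2 * (n choose 2)) \<le> real (n * n)" by (simp only: of_nat_le_iff)
      then show ?thesis by (simp add: power2_eq_square)
    qed
    have "- (?p + 2 * ?p\<^sup>2) \<le> ln (1 - ?p)"
      using ln_one_minus_pos_lower_bound[OF p] by simp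
    then have "real (n choose 2) * - (?p + 2 * ?p\<^sup>2) \<le> real (n choose 2) * ln (1 - ?p)"
      by (intro mult_left_mono) auto
    moreover have "real (n choose 2) * (?p + 2 * ?p\<^sup>2) \<le> (real n)\<^sup>2 / 2 * (?p + 2 * ?p\<^sup>2)"
      using ch p by (intro mult_right_mono) auto
    moreover have "(real n)\<^sup>2 / 2 * (?p + 2 * ?p\<^sup>2) = d * (real n / 2 + d)"
      using n by (simp add: field_simps power2_eq_square)
    ultimately have "- (d * (real n / 2 + d)) \<le> real (n choose 2) * ln (1 - ?p)" by linarith
    then have "- (d * (real n / 2 + d)) / d \<le> real (n choose 2) * ln (1 - ?p) / d"
      using d_pos by (intro divide_right_mono) auto
    moreover have "- (d * (real n / 2 + d)) / d = - (real n / 2 + d)" using d_pos by simp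
    ultimately have "- (real n / 2 + d) \<le> real (n choose 2) * ln (1 - ?p) / d" by linarith
    then show ?thesis by linarith
  qed
  have H: "2 * J / d \<le> profile_entropy"
    using J(2) d_pos profile_entropy_lower_bound[of N]
    by (smt (verit) divide_right_mono)
  have "real n * J / d - 2 * J = (real n / 2 - d) * (2 * J / d)"
    using d_pos by (simp add: field_simps)
  also have "\<dots> \<le> (real n / 2 - d) * profile_entropy"
    using H n by (intro mult_left_mono) auto
  also have "\<dots> \<le> (real n + real (n choose 2) * ln (1 - ?p) / d) * profile_entropy"
    using 2 profile_entropy_nonneg by (intro mult_right_mono) auto
  also have "\<dots> = real n * profile_entropy + real (n choose 2) * ln (1 - ?p) * (profile_entropy / d)"
    by (simp add: algebra_simps)
  finally have \<mu>: "real n * J / d - 2 * J - 64 * a\<^sup>2 * real n \<le> \<mu>" using 1 by linarith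
  have "measure_pmf.prob P {E. ?f E \<le> real n * J / d - 2 * J - 64 * a\<^sup>2 * real n - s}
      \<le> measure_pmf.prob P {E \<in> space (measure_pmf P). exp (s - \<mu>) \<le> exp (- ?f E)}"
    using \<mu> by (intro measure_pmf.finite_measure_mono) auto
  also have "\<dots> \<le> measure_pmf.expectation P (\<lambda>E. exp (- ?f E)) / exp (s - \<mu>)"
    by (intro integral_Markov_inequality_measure[where A = "{}"]) (auto simp: P_def)
  also have "\<dots> \<le> exp (- \<mu> + real n * (8 * a)\<^sup>2) / exp (s - \<mu>)"
    using down by (intro divide_right_mono) auto
  also have "\<dots> = exp (64 * a\<^sup>2 * real n - s)"
    by (simp add: power_mult_distrib mult_ac flip: exp_diff)
  finally show ?thesis .
qed

text \<open>The first moment bound is about \<open>exp (n * ln 2 - d * \<eta>^2 * n / 2)\<close>,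
  and \<open>d * \<eta>^2 \<ge> 2\<close> makes the exponent at most \<open>(ln 2 - 1) * n\<close>
  plus a constant.\<close>

lemma independent_set_prob_tendsto_0:
  fixes \<eta> d :: real
  assumes \<eta>: "\<eta> > 0" and d: "d * \<eta>\<^sup>2 \<ge> 2"
  shows "(\<lambda>n. measure_pmf.prob (erdos_renyi n (d / real n))
    {E. \<exists>S. S \<subseteq> {1..n} \<and> nat \<lceil>\<eta> * real n\<rceil> \<le> card S \<and> (\<forall>e\<in>E. \<not> e \<subseteq> S)}) \<longlonglongrightarrow> 0"
proof -
  have d_pos: "d > 0" using d \<eta> by (smt (verit) mult_nonpos_nonneg zero_le_power2)
  have "\<forall>\<^sub>F n in sequentially. real n \<ge> max d (1 / \<eta>)" by real_asymp
  then have ev: "\<forall>\<^sub>F n in sequentially. measure_pmf.prob (erdos_renyi n (d / real n))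
    {E. \<exists>S. S \<subseteq> {1..n} \<and> nat \<lceil>\<eta> * real n\<rceil> \<le> card S \<and> (\<forall>e\<in>E. \<not> e \<subseteq> S)} \<le> exp ((ln 2 - 1) * real n + d * \<eta> / 2)"
  proof eventually_elim
    case (elim n)
    define s where "s = nat \<lceil>\<eta> * real n\<rceil>"
    have n: "real n > 0" "real n \<ge> d" "\<eta> * real n \<ge> 1" using elim d_pos \<eta> by (auto simp: field_simps)
    have p: "0 \<le> d / real n" "d / real n \<le> 1" using n d_pos by (auto simp: field_simps)
    have s: "real s \<ge> \<eta> * real n" unfolding s_def by linarith
    have "real (s choose 2) = real s * (real s - 1) / 2"
    proof -
      have "even (s * (s - 1))" by (cases "even s") auto
      then have "real (s choose 2) = real (s * (s - 1)) / 2" by (simp add: choose_two real_of_nat_div)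
      also have "real (s * (s - 1)) = real s * (real s - 1)"
        using s n by (cases s) (auto simp: algebra_simps)
      finally show ?thesis .
    qed
    also have "\<dots> \<ge> (\<eta> * real n) * (\<eta> * real n - 1) / 2"
      using s n by (intro divide_right_mono mult_mono) auto
    finally have ch: "real (s choose 2) \<ge> (\<eta> * real n) * (\<eta> * real n - 1) / 2" .
    have "2 ^ n * (1 - d / real n) ^ (s choose 2) \<le> exp (real n * ln 2) * exp (- (d / real n)) ^ (s choose 2)"
    proof (intro mult_mono power_mono)
      show "1 - d / real n \<le> exp (- (d / real n))" using exp_ge_add_one_self[of "- (d / real n)"] by simp
      show "2 ^ n \<le> exp (real n * ln 2)" by (simp add: exp_of_nat_mult)
    qed (use p in auto)
    also have "\<dots> = exp (real n * ln 2 - real (s choose 2) * (d / real n))"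
      by (simp add: exp_diff exp_minus exp_of_nat_mult[symmetric] power_inverse field_simps)
    also have "\<dots> \<le> exp (real n * ln 2 - (\<eta> * real n) * (\<eta> * real n - 1) / 2 * (d / real n))"
      using mult_right_mono[OF ch p(1)] by simp
    also have "(\<eta> * real n) * (\<eta> * real n - 1) / 2 * (d / real n) = (d * \<eta>\<^sup>2) * (real n / 2) - d * \<eta> / 2"
      using n by (simp add: field_simps power2_eq_square)
    also have "exp (real n * ln 2 - ((d * \<eta>\<^sup>2) * (real n / 2) - d * \<eta> / 2)) \<le> exp ((ln 2 - 1) * real n + d * \<eta> / 2)"
      using mult_right_mono[OF d, of "real n / 2"] by (simp add: algebra_simps)
    finally show ?case
      using erdos_renyi_independent_set_prob[OF p, of n s] unfolding s_def by linarith
  qed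
  have "(\<lambda>n. exp ((ln 2 - 1) * real n + d * \<eta> / 2)) \<longlonglongrightarrow> 0"
  proof -
    have "ln 2 < (1 :: real)" using ln_2_less_1 by simp
    then have "filterlim (\<lambda>n. (ln 2 - 1) * real n + d * \<eta> / 2) at_bot sequentially"
      by real_asymp
    then show ?thesis by (rule filterlim_compose[OF exp_at_bot])
  qed
  from tendsto_sandwich[OF _ ev tendsto_const this] show ?thesis by simp
qed

theorem theorem3p3:
  fixes \<epsilon> :: real
  assumes "\<epsilon> > 0"
  shows "\<exists>d\<^sub>0 :: real. \<forall>d \<ge> d\<^sub>0.
    (\<lambda>n :: nat. measure_pmf.prob (erdos_renyi n (d / real n))
        {E. ln (growth_constant {1..n} E) \<ge> (pi\<^sup>2 / 6 - \<epsilon>) / d})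
      \<longlonglongrightarrow> 1"
proof -
  \<comment> \<open>The cap at 1 keeps \<open>pi^2 / 6 - \<delta>\<close> nonnegative, as
    \<open>ln_growth_constant_ge\<close> requires of its \<open>t\<close>.\<close>
  define \<delta> where "\<delta> = min \<epsilon> 1"
  have \<delta>: "0 < \<delta>" "\<delta> \<le> 1" "\<delta> \<le> \<epsilon>" using assms by (auto simp: \<delta>_def)
  obtain K N where K: "K \<ge> 1"
    and KN: "(\<Sum>n<N. dilog_term n (logistic K) - dilog_term n (logistic (- K))) \<ge> pi\<^sup>2 / 6 - \<delta> / 8"
    using ex_dilog_sum_ge[of "\<delta> / 8"] \<delta> by auto
  define J where "J = pi\<^sup>2 / 6 - \<delta> / 8"
  have pi: "pi\<^sup>2 / 6 \<ge> 3 / 2" using power_mono[of 3 pi 2] pi_gt3 by simp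
  then have J: "J \<ge> 0" using \<delta> by (simp add: J_def)
  \<comment> \<open>With at most about \<open>\<eta> * n\<close> roots, each costing
    \<open>2 * a = 2 * K / d\<close>, the loss from the roots is at most
    \<open>\<delta> / 8 * n / d\<close> up to a constant.\<close>
  define \<eta> where "\<eta> = \<delta> / (16 * K)"
  have \<eta>: "\<eta> > 0" "\<eta> \<le> 1 / 16" "2 * K * \<eta> = \<delta> / 8" using \<delta> K by (auto simp: \<eta>_def field_simps)
  \<comment> \<open>The three terms give in turn \<open>8 * a \<le> 1\<close> for the exponential
    moments, \<open>64 * a^2 \<le> \<delta> / (16 * d)\<close> for the fluctuations, and
    \<open>d * \<eta>^2 \<ge> 2\<close> for the independent sets.\<close>
  define d0 where "d0 = 8 * K + 1024 * K\<^sup>2 / \<delta> + 2 / \<eta>\<^sup>2"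
  show ?thesis
  proof (intro exI[of _ d0] allI impI)
    fix d :: real assume dd0: "d \<ge> d0"
    have nonneg: "1024 * K\<^sup>2 / \<delta> \<ge> 0" "2 / \<eta>\<^sup>2 \<ge> 0" using \<delta> by auto
    have d: "8 * K \<le> d" "1024 * K\<^sup>2 / \<delta> \<le> d" "2 / \<eta>\<^sup>2 \<le> d"
      using dd0 K nonneg unfolding d0_def by linarith+
    have d\<eta>: "d * \<eta>\<^sup>2 \<ge> 2" using d(3) \<eta> by (simp add: field_simps)
    interpret truncated_profile d K using K d(1) by unfold_locales auto
    have aa: "64 * a\<^sup>2 \<le> \<delta> / (16 * d)"
    proof -
      have "1024 * K\<^sup>2 \<le> d * \<delta>" using d(2) \<delta> by (simp add: field_simps)
      then have "1024 * K\<^sup>2 / (16 * d\<^sup>2) \<le> d * \<delta> / (16 * d\<^sup>2)" by (intro divide_right_mono) auto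
      then show ?thesis using d_pos by (simp add: a_def field_simps power2_eq_square)
    qed
    let ?P = "\<lambda>n. measure_pmf (erdos_renyi n (d / real n))"
    define good where "good n = {E. ln (growth_constant {1..n} E) \<ge> (pi\<^sup>2 / 6 - \<epsilon>) / d}" for n :: nat
    \<comment> \<open>The allowed deviation \<open>\<delta> / (8 * d) * n\<close> is at least twice
      \<open>64 * a^2 * n\<close>, so the tail bound decays at least as fast as
      \<open>exp (- (\<delta> / (16 * d)) * n)\<close>.\<close>
    define bad1 where "bad1 n = {E. ln (box_volume a {1..n} E) \<le>
      real n * J / d - 2 * J - 64 * a\<^sup>2 * real n - \<delta> / (8 * d) * real n}" for n :: nat
    define bad2 where "bad2 n = {E. \<exists>S. S \<subseteq> {1..n} \<and> nat \<lceil>\<eta> * real n\<rceil> \<le> card S \<and> (\<forall>e\<in>E. \<not> e \<subseteq> S)}" for n :: nat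
    have lim1: "(\<lambda>n. measure (?P n) (bad1 n)) \<longlonglongrightarrow> 0"
    proof (rule tendsto_sandwich[OF _ _ tendsto_const])
      have "\<forall>\<^sub>F n in sequentially. real n \<ge> max (2 * d) 1" by real_asymp
      then show "\<forall>\<^sub>F n in sequentially. measure (?P n) (bad1 n) \<le> exp (- (\<delta> / (16 * d)) * real n)"
      proof eventually_elim
        case (elim n)
        then have n: "2 * d \<le> real n" "n > 0" by auto
        have "measure (?P n) (bad1 n) \<le> exp (64 * a\<^sup>2 * real n - \<delta> / (8 * d) * real n)"
          unfolding bad1_def using ln_box_volume_lower_tail[OF d(1) n J, of N] KN by (simp add: J_def)
        also have "64 * a\<^sup>2 * real n - \<delta> / (8 * d) * real n \<le> - (\<delta> / (16 * d)) * real n"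
          using mult_right_mono[OF aa, of "real n"] by (simp add: field_simps)
        finally show ?case by simp
      qed
      show "(\<lambda>n. exp (- (\<delta> / (16 * d)) * real n)) \<longlonglongrightarrow> 0"
      proof -
        have "\<delta> / (16 * d) > 0" using \<delta> d_pos by simp
        then have "filterlim (\<lambda>n. - (\<delta> / (16 * d)) * real n) at_bot sequentially" by real_asymp
        then show ?thesis by (rule filterlim_compose[OF exp_at_bot])
      qed
    qed auto
    have lim2: "(\<lambda>n. measure (?P n) (bad2 n)) \<longlonglongrightarrow> 0"
      unfolding bad2_def by (rule independent_set_prob_tendsto_0[OF \<eta>(1) d\<eta>])
    have incl: "\<forall>\<^sub>F n in sequentially. 1 - measure (?P n) (bad1 n) - measure (?P n) (bad2 n) \<le> measure (?P n) (good n)"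
    proof -
      have "\<forall>\<^sub>F n in sequentially. real n \<ge> max 2 (d * (8 * J + 8) / \<delta>)" by real_asymp
      then show ?thesis
      proof eventually_elim
        case (elim n)
        then have n: "real n \<ge> 2" "real n * \<delta> \<ge> d * (8 * J + 8)" using \<delta> by (auto simp: field_simps)
        have cover: "E \<in> good n" if E: "E \<in> set_pmf (erdos_renyi n (d / real n))" "E \<notin> bad1 n" "E \<notin> bad2 n" for E
        proof -
          have EU: "E \<subseteq> all_edges {1..n}" using E(1) set_erdos_renyi by blast
          define s where "s = nat \<lceil>\<eta> * real n\<rceil>"
          have s: "real s \<le> \<eta> * real n + 1" using \<eta>(1) unfolding s_def by (simp add: of_nat_nat)
          have "\<eta> * real n \<le> 1 / 16 * real n" using \<eta>(2) by (intro mult_right_mono) auto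
          then have "real s \<le> real n" using s n by linarith
          then have sn: "s \<le> card {1..n}" by simp
          let ?t = "(pi\<^sup>2 / 6 - \<delta>) / d"
          have "ln (growth_constant {1..n} E) \<ge> ?t"
          proof (rule ln_growth_constant_ge)
            show "finite_graph {1..n} E" using EU by (simp add: finite_graph_def)
            show "a \<ge> 0" using a_pos by simp
            show "?t \<ge> 0" using pi \<delta> d_pos by simp
            show "card S < s" if "S \<subseteq> {1..n}" "\<forall>e\<in>E. \<not> e \<subseteq> S" for S
            proof -
              have "\<not> s \<le> card S" using E(3) that unfolding bad2_def s_def by blast
              then show ?thesis by simp
            qed
            show "s \<le> card {1..n}" by (rule sn)
            have "real s * (2 * a) \<le> (\<eta> * real n + 1) * (2 * a)"
              using s a_pos by (intro mult_right_mono) auto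
            also have "\<dots> = 2 * K * \<eta> * real n / d + 2 * a"
              using d_pos by (simp add: a_def field_simps)
            also have "\<dots> = \<delta> / 8 * real n / d + 2 * a" by (simp add: \<eta>(3))
            finally have 1: "real s * (2 * a) \<le> \<delta> / 8 * real n / d + 1" using a_less_half by linarith
            have 2: "ln (box_volume a {1..n} E) >
              real n * J / d - 2 * J - 64 * a\<^sup>2 * real n - \<delta> / (8 * d) * real n"
              using E(2) unfolding bad1_def by simp
            have 3: "64 * a\<^sup>2 * real n \<le> \<delta> / 16 * (real n / d)"
              using mult_right_mono[OF aa, of "real n"] by simp
            have 4: "8 * J + 8 \<le> \<delta> * (real n / d)"
              using n(2) d_pos by (simp add: field_simps)
            have 5: "real n * J / d = (pi\<^sup>2 / 6) * (real n / d) - \<delta> / 8 * (real n / d)"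
              using d_pos by (simp add: J_def field_simps)
            have 6: "real (card {1..n}) * ?t = (pi\<^sup>2 / 6) * (real n / d) - \<delta> * (real n / d)"
              using d_pos by (simp add: field_simps)
            \<comment> \<open>In units of \<open>Y\<close> the losses are 1/8 from \<open>J\<close>,
              1/16 from \<open>64 * a^2 * n\<close>, 1/8 from the deviation and 1/8 from the roots,
              in all 7/16. The target allows a loss of \<open>Y\<close>, and the remaining 9/16
              absorb the constants \<open>2 * J + 1\<close>, since \<open>Y \<ge> 8 * J + 8\<close>
              for large \<open>n\<close>.\<close>
            define Y where "Y = \<delta> * (real n / d)"
            define B where "B = pi\<^sup>2 / 6 * (real n / d)"
            have Y: "\<delta> / 8 * real n / d = Y / 8" "\<delta> / (8 * d) * real n = Y / 8"
              "\<delta> / 8 * (real n / d) = Y / 8" "\<delta> / 16 * (real n / d) = Y / 16"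
              by (simp_all add: Y_def)
            show "real (card {1..n}) * ?t + real s * (2 * a) \<le> ln (box_volume a {1..n} E)"
              using 1 2 3 4 J unfolding 5 6 Y Y_def[symmetric] B_def[symmetric] by linarith
          qed
          moreover have "(pi\<^sup>2 / 6 - \<epsilon>) / d \<le> ?t" using \<delta> d_pos by (intro divide_right_mono) auto
          ultimately show ?thesis unfolding good_def by simp
        qed
        have "1 = measure (?P n) (set_pmf (erdos_renyi n (d / real n)))"
          by (simp add: measure_pmf.prob_eq_1 AE_measure_pmf)
        also have "\<dots> \<le> measure (?P n) (good n \<union> bad1 n \<union> bad2 n)"
          using cover by (intro measure_pmf.finite_measure_mono) auto
        also have "\<dots> \<le> measure (?P n) (good n \<union> bad1 n) + measure (?P n) (bad2 n)"
          by (intro measure_Un_le) auto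
        also have "measure (?P n) (good n \<union> bad1 n) \<le> measure (?P n) (good n) + measure (?P n) (bad1 n)"
          by (intro measure_Un_le) auto
        finally show ?case by linarith
      qed
    qed
    have "(\<lambda>n. measure (?P n) (good n)) \<longlonglongrightarrow> 1"
    proof (rule tendsto_sandwich[OF incl _ _ tendsto_const])
      show "(\<lambda>n. 1 - measure (?P n) (bad1 n) - measure (?P n) (bad2 n)) \<longlonglongrightarrow> 1"
        using tendsto_diff[OF tendsto_diff[OF tendsto_const lim1] lim2, of 1] by simp
    qed auto
    then show "(\<lambda>n. measure_pmf.prob (erdos_renyi n (d / real n))
        {E. ln (growth_constant {1..n} E) \<ge> (pi\<^sup>2 / 6 - \<epsilon>) / d}) \<longlonglongrightarrow> 1"
      unfolding good_def .
  qed
qed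

end
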